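(* Let $r\ge 1$, $s\ge 0$, let $t>0$ be small, and assume the following. (a) $K(\epsilon,\rho)$ is a non-negative continuous function with compact support, $(\epsilon,\rho)\in[0,R]\times[0,R]$ ($R>0$ fixed), and $\mathcal{K}_1=\sup_{\frac{s}{R}\le \epsilon,\rho\le R}K(\epsilon,\rho)$. (b) $b(\epsilon,\rho,\sigma)$ is a non-negative continuous function satisfying $\int_0^\infty \epsilon^{-\theta s}b(\epsilon,\rho,\sigma)\,d\epsilon\le \eta\,\rho^{-\theta s}$, where $\theta,\eta>0$ are constants. (c) $L_0$ is a fixed constant such that $\|g\|\le L_0$ for the functions $g$ to which the operator $\mathcal{S}$ is applied, namely the exact solution $f$ and the truncated solutions $\Upsilon_m$, $m\ge 0$. Set $\mu=\max\{\bar N,\eta\}$ and $\xi=2t\mathcal{K}_1(\mu+1)L_0$, with $\xi<1$. Let $\Upsilon_m=\sum_{i=0}^m f_i$ be the $m$th-order truncated accelerated homotopy perturbation method (AHPM) solution of the collision-induced breakage equation, and suppose $\|f_1\|<\infty$. Then $\Upsilon_m$ converges, as $m\to\infty$, to the exact solution $f$ of the collision-induced breakage equation, with the error bound $$\|f-\Upsilon_m\|\le \frac{\xi^m}{1-\xi}\,\|f_1\| .$$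
   Context: The collision-induced breakage equation, for the unknown concentration $f(\varsigma,\epsilon)\ge 0$ (time $\varsigma\ge 0$, particle size $\epsilon\in\mathbb{R}^+=(0,\infty)$), is $$\frac{\partial f(\varsigma,\epsilon)}{\partial\varsigma}=\int_0^\infty\int_\epsilon^\infty K(\rho,\sigma)b(\epsilon,\rho,\sigma)f(\varsigma,\rho)f(\varsigma,\sigma)\,d\rho\,d\sigma-\int_0^\infty K(\epsilon,\rho)f(\varsigma,\epsilon)f(\varsigma,\rho)\,d\rho,\qquad f(0,\epsilon)=f^{in}(\epsilon)\ge 0.$$ The collision kernel satisfies $K(\rho,\sigma)=K(\sigma,\rho)\ge 0$. The breakage function $b$ satisfies $b(\epsilon,\rho,\sigma)\ne 0$ for $\epsilon\in(0,\rho)$, $b(\epsilon,\rho,\sigma)=0$ for $\epsilon>\rho$, and, for all $\rho,\sigma>0$, $\int_0^\rho \epsilon\, b(\epsilon,\rho,\sigma)\,d\epsilon=\rho$ and $\int_0^\rho b(\epsilon,\rho,\sigma)\,d\epsilon=\bar N(\rho,\sigma)<\infty$. In the definition of $\mu$, $\bar N$ denotes a constant upper bound of $\bar N(\rho,\sigma)$. Function space: $\mathbb{Y}_{r,s}(t)$ is the space of continuous functions $f$ on $[0,t]\times(0,\infty)$ with finite norm $$\|f\|=\sup_{\varsigma\in[0,t]}\int_0^\infty\Big(\epsilon^r+\frac1{\epsilon^{2s}}\Big)|f(\varsigma,\epsilon)|\,d\epsilon ,$$ and $\mathbb{Y}^+_{r,s}(t)$ is its subset of non-negative functions. Convergence is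 in this norm. Integrated form: put $$N[f](\varsigma,\epsilon)=\int_0^\varsigma\Big[\int_0^\infty\int_\epsilon^\infty K(\rho,\sigma)b(\epsilon,\rho,\sigma)f(\tau,\rho)f(\tau,\sigma)\,d\rho\,d\sigma-\int_0^\infty K(\epsilon,\rho)f(\tau,\epsilon)f(\tau,\rho)\,d\rho\Big]d\tau$$ and $\mathcal{S}f=f^{in}+N[f]$, $\mathcal{S}:\mathbb{Y}_{r,s}(t)\to\mathbb{Y}_{r,s}(t)$. The exact solution is the solution $f\in\mathbb{Y}^+_{r,s}(t)$ of $f=\mathcal{S}f$. AHPM terms: $f_0(\varsigma,\epsilon)=f^{in}(\epsilon)$ and $f_n=\hat H_{n-1}$ for $n\ge 1$, where the accelerated polynomials are $\hat H_0=N[f_0]$ and $$\hat H_n=N\Big[\sum_{i=0}^n f_i\Big]-\sum_{i=0}^{n-1}\hat H_i,\qquad n\ge 1 .$$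
   Formalization: For s>0 the formal theorem additionally assumes K≤𝒦₁ on all of (0,R]² and θ≥2; without these the bound fails (K supported in [0,s/R)² gives ξ=0; for θ<2 the moment of b of order −2s is not controlled by μ). *)

theory Defs
  imports "HOL-Analysis.Analysis"
begin

text \<open>
  Functions of time and size are curried, time first; only their values on
  \<open>{0..t} \<times> {0<..}\<close> matter.  The norm takes values in \<^typ>\<open>ennreal\<close>, so that it is
  genuinely infinite outside the space.
\<close>

definition Ynorm :: "real \<Rightarrow> real \<Rightarrow> real \<Rightarrow> (real \<Rightarrow> real \<Rightarrow> real) \<Rightarrow> ennreal" where
  "Ynorm r s t f =
     (SUP \<tau>\<in>{0..t}. \<integral>\<^sup>+\<epsilon>\<in>{0<..}. ennreal ((\<epsilon> powr r + 1 / \<epsilon> powr (2 * s)) * \<bar>f \<tau> \<epsilon>\<bar>) \<partial>lborel)"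

definition Yspace :: "real \<Rightarrow> real \<Rightarrow> real \<Rightarrow> (real \<Rightarrow> real \<Rightarrow> real) set" where
  "Yspace r s t =
     {f. continuous_on ({0..t} \<times> {0<..}) (\<lambda>(\<tau>, \<epsilon>). f \<tau> \<epsilon>) \<and> Ynorm r s t f < \<infinity>}"

definition Yplus :: "real \<Rightarrow> real \<Rightarrow> real \<Rightarrow> (real \<Rightarrow> real \<Rightarrow> real) set" where
  "Yplus r s t = {f \<in> Yspace r s t. \<forall>\<tau>\<in>{0..t}. \<forall>\<epsilon>>0. 0 \<le> f \<tau> \<epsilon>}"

definition breakage_N ::
  "(real \<Rightarrow> real \<Rightarrow> real) \<Rightarrow> (real \<Rightarrow> real \<Rightarrow> real \<Rightarrow> real) \<Rightarrow>
   (real \<Rightarrow> real \<Rightarrow> real) \<Rightarrow> real \<Rightarrow> real \<Rightarrow> real" where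
  "breakage_N K b f t \<epsilon> =
     (LINT \<tau>:{0..t}|lborel.
        (LINT \<sigma>:{0<..}|lborel. (LINT \<rho>:{\<epsilon><..}|lborel. K \<rho> \<sigma> * b \<epsilon> \<rho> \<sigma> * f \<tau> \<rho> * f \<tau> \<sigma>))
        - (LINT \<rho>:{0<..}|lborel. K \<epsilon> \<rho> * f \<tau> \<epsilon> * f \<tau> \<rho>))"

definition breakage_S ::
  "(real \<Rightarrow> real \<Rightarrow> real) \<Rightarrow> (real \<Rightarrow> real \<Rightarrow> real \<Rightarrow> real) \<Rightarrow> (real \<Rightarrow> real) \<Rightarrow>
   (real \<Rightarrow> real \<Rightarrow> real) \<Rightarrow> real \<Rightarrow> real \<Rightarrow> real" where
  "breakage_S K b f_in f t \<epsilon> = f_in \<epsilon> + breakage_N K b f t \<epsilon>"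

definition exact_solution ::
  "real \<Rightarrow> real \<Rightarrow> real \<Rightarrow> (real \<Rightarrow> real \<Rightarrow> real) \<Rightarrow> (real \<Rightarrow> real \<Rightarrow> real \<Rightarrow> real) \<Rightarrow>
   (real \<Rightarrow> real) \<Rightarrow> (real \<Rightarrow> real \<Rightarrow> real) \<Rightarrow> bool" where
  "exact_solution r s t K b f_in f \<longleftrightarrow>
     f \<in> Yplus r s t \<and> (\<forall>\<tau>\<in>{0..t}. \<forall>\<epsilon>>0. f \<tau> \<epsilon> = breakage_S K b f_in f \<tau> \<epsilon>)"

function
  ahpm_f :: "(real \<Rightarrow> real \<Rightarrow> real) \<Rightarrow> (real \<Rightarrow> real \<Rightarrow> real \<Rightarrow> real) \<Rightarrow> (real \<Rightarrow> real) \<Rightarrow>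
     nat \<Rightarrow> real \<Rightarrow> real \<Rightarrow> real" and
  ahpm_H :: "(real \<Rightarrow> real \<Rightarrow> real) \<Rightarrow> (real \<Rightarrow> real \<Rightarrow> real \<Rightarrow> real) \<Rightarrow> (real \<Rightarrow> real) \<Rightarrow>
     nat \<Rightarrow> real \<Rightarrow> real \<Rightarrow> real"
where
  "ahpm_f K b f_in 0 = (\<lambda>\<tau> \<epsilon>. f_in \<epsilon>)"
| "ahpm_f K b f_in (Suc n) = ahpm_H K b f_in n"
| "ahpm_H K b f_in 0 = breakage_N K b (ahpm_f K b f_in 0)"
| "ahpm_H K b f_in (Suc n) =
     (\<lambda>\<tau> \<epsilon>. breakage_N K b (\<lambda>\<tau>' \<epsilon>'. \<Sum>i\<le>Suc n. ahpm_f K b f_in i \<tau>' \<epsilon>') \<tau> \<epsilon>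
             - (\<Sum>i\<le>n. ahpm_H K b f_in i \<tau> \<epsilon>))"
  by pat_completeness auto
termination
  by (relation "Wellfounded.measure (\<lambda>x. case x of Inl (K, b, f_in, n) \<Rightarrow> 2 * n
                                                 | Inr (K, b, f_in, n) \<Rightarrow> 2 * n + 1)") auto

definition ahpm_sol ::
  "(real \<Rightarrow> real \<Rightarrow> real) \<Rightarrow> (real \<Rightarrow> real \<Rightarrow> real \<Rightarrow> real) \<Rightarrow> (real \<Rightarrow> real) \<Rightarrow>
   nat \<Rightarrow> real \<Rightarrow> real \<Rightarrow> real" where
  "ahpm_sol K b f_in m \<tau> \<epsilon> = (\<Sum>i\<le>m. ahpm_f K b f_in i \<tau> \<epsilon>)"

end

theory Submission
  imports Defs
begin

text \<open>
  The accelerated polynomials telescope, so that \<open>\<Upsilon>\<^sub>m\<^sub>+\<^sub>1 = S \<Upsilon>\<^sub>m\<close>: the truncated solutions are the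
  Picard iterates of \<open>S\<close>, and it suffices that \<open>S\<close> contracts by \<open>\<xi>\<close> on the ball of radius \<open>L0\<close>.  With
  \<open>w \<epsilon> = \<epsilon>\<^sup>r + \<epsilon>\<^sup>-\<^sup>2\<^sup>s\<close>, Tonelli's theorem moves the \<open>\<epsilon>\<close>-integral of the gain term onto
  \<open>w \<epsilon> * b \<epsilon> \<rho> \<sigma>\<close>, whose integral is at most \<open>\<mu> * w \<rho>\<close>; the loss term contributes \<open>w \<rho>\<close>.  What is left is
  the integral of \<open>w \<rho> * \<bar>u \<rho> * u \<sigma> - v \<rho> * v \<sigma>\<bar>\<close>, at most \<open>2 * L0 * \<parallel>u - v\<parallel>\<close> because \<open>w \<ge> 1\<close>.

  The gain integrals need not converge at every \<open>\<epsilon>\<close>, where the Bochner integral takes its junk value \<open>0\<close>.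
  The same estimate applied to \<open>u\<close> alone shows that they converge absolutely for almost every \<open>\<epsilon>\<close>,
  which is all that the norm sees.
\<close>

section \<open>Measurability of curried functions and the Tonelli estimate\<close>

lemma borel_measurable_curried2:
  assumes "(\<lambda>(x, y). F x y) \<in> borel_measurable (A \<Otimes>\<^sub>M B)"
    and "f \<in> measurable M A" "g \<in> measurable M B"
  shows "(\<lambda>x. F (f x) (g x)) \<in> borel_measurable M"
  using measurable_compose[OF measurable_Pair[OF assms(2,3)] assms(1)] by simp

text \<open>Joint measurability is assumed on tuples below, whereas the integrands apply curried
  functions to permuted or renamed variables, as in \<open>D \<tau> \<epsilon> \<rho>\<close>.
  Instantiating the first premise gives a rule that the measurability prover can use on any such
  arguments.\<close>

lemma borel_measurable_curried3:
  assumes "(\<lambda>(x, y, z). F x y z) \<in> borel_measurable (A \<Otimes>\<^sub>M B \<Otimes>\<^sub>M C)"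
    and "f \<in> measurable M A" "g \<in> measurable M B" "h \<in> measurable M C"
  shows "(\<lambda>x. F (f x) (g x) (h x)) \<in> borel_measurable M"
  using measurable_compose[OF measurable_Pair[OF assms(2) measurable_Pair[OF assms(3,4)]] assms(1)]
  by simp

text \<open>Everything is \<open>ennreal\<close>-valued, so the integrals can be exchanged before
  any convergence is known. \<open>D\<close> is a placeholder, later the absolute value of
  \<open>h \<tau> \<rho> * h \<tau> \<sigma>\<close> for one function or of the difference of two
  such products; one estimate thus gives both finiteness and the Lipschitz bound. In the factor
  \<open>\<mu> + 1\<close>, the gain contributes \<open>\<mu>\<close> and the loss
  \<open>1\<close>.\<close>

lemma nn_integral_breakage_le:
  fixes w :: "real \<Rightarrow> ennreal" and K :: "real \<Rightarrow> real \<Rightarrow> ennreal"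
    and b D :: "real \<Rightarrow> real \<Rightarrow> real \<Rightarrow> ennreal"
  assumes [measurable]: "w \<in> borel_measurable borel"
    and meas: "(\<lambda>(\<rho>, \<sigma>). K \<rho> \<sigma>) \<in> borel_measurable (borel \<Otimes>\<^sub>M borel)"
    "(\<lambda>(\<epsilon>, \<rho>, \<sigma>). b \<epsilon> \<rho> \<sigma>) \<in> borel_measurable (borel \<Otimes>\<^sub>M borel \<Otimes>\<^sub>M borel)"
    "(\<lambda>(\<tau>, \<rho>, \<sigma>). D \<tau> \<rho> \<sigma>) \<in> borel_measurable (borel \<Otimes>\<^sub>M borel \<Otimes>\<^sub>M borel)"
    and K: "\<And>\<rho> \<sigma>. K \<rho> \<sigma> \<le> k"
    and b: "\<And>\<rho> \<sigma>. (\<integral>\<^sup>+\<epsilon>. w \<epsilon> * b \<epsilon> \<rho> \<sigma> \<partial>lborel) \<le> \<mu> * w \<rho>"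
  shows "(\<integral>\<^sup>+\<epsilon>. w \<epsilon> * ((\<integral>\<^sup>+\<tau>. \<integral>\<^sup>+\<sigma>. \<integral>\<^sup>+\<rho>. K \<rho> \<sigma> * b \<epsilon> \<rho> \<sigma> * D \<tau> \<rho> \<sigma> \<partial>lborel \<partial>lborel \<partial>lborel)
            + (\<integral>\<^sup>+\<tau>. \<integral>\<^sup>+\<rho>. K \<epsilon> \<rho> * D \<tau> \<epsilon> \<rho> \<partial>lborel \<partial>lborel)) \<partial>lborel)
    \<le> k * (\<mu> + 1) * (\<integral>\<^sup>+\<tau>. \<integral>\<^sup>+\<sigma>. \<integral>\<^sup>+\<rho>. w \<rho> * D \<tau> \<rho> \<sigma> \<partial>lborel \<partial>lborel \<partial>lborel)"
    (is "?L \<le> _ * ?I")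
proof -
  note [measurable] = borel_measurable_curried2[OF meas(1)]
    borel_measurable_curried3[OF meas(2)] borel_measurable_curried3[OF meas(3)]
  have gain: "(\<integral>\<^sup>+\<epsilon>. w \<epsilon> * (\<integral>\<^sup>+\<tau>. \<integral>\<^sup>+\<sigma>. \<integral>\<^sup>+\<rho>. K \<rho> \<sigma> * b \<epsilon> \<rho> \<sigma> * D \<tau> \<rho> \<sigma> \<partial>lborel \<partial>lborel \<partial>lborel) \<partial>lborel)
      \<le> k * \<mu> * ?I"
  proof -
    have "(\<integral>\<^sup>+\<epsilon>. w \<epsilon> * (\<integral>\<^sup>+\<tau>. \<integral>\<^sup>+\<sigma>. \<integral>\<^sup>+\<rho>. K \<rho> \<sigma> * b \<epsilon> \<rho> \<sigma> * D \<tau> \<rho> \<sigma> \<partial>lborel \<partial>lborel \<partial>lborel) \<partial>lborel)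
        = (\<integral>\<^sup>+\<epsilon>. \<integral>\<^sup>+\<tau>. \<integral>\<^sup>+\<sigma>. \<integral>\<^sup>+\<rho>. K \<rho> \<sigma> * D \<tau> \<rho> \<sigma> * (w \<epsilon> * b \<epsilon> \<rho> \<sigma>) \<partial>lborel \<partial>lborel \<partial>lborel \<partial>lborel)"
      by (subst nn_integral_cmult[symmetric], measurable)+ (simp add: ac_simps)
    \<comment> \<open>The integral over \<open>\<epsilon>\<close> moves inwards past
      \<open>\<tau>\<close>, \<open>\<sigma>\<close> and \<open>\<rho>\<close>, one exchange at a
      time, until it acts on \<open>w \<epsilon> * b \<epsilon> \<rho> \<sigma>\<close>
      alone.\<close>
    also have "\<dots> = (\<integral>\<^sup>+\<tau>. \<integral>\<^sup>+\<epsilon>. \<integral>\<^sup>+\<sigma>. \<integral>\<^sup>+\<rho>. K \<rho> \<sigma> * D \<tau> \<rho> \<sigma> * (w \<epsilon> * b \<epsilon> \<rho> \<sigma>) \<partial>lborel \<partial>lborel \<partial>lborel \<partial>lborel)"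
      by (rule lborel_pair.Fubini') measurable
    also have "\<dots> = (\<integral>\<^sup>+\<tau>. \<integral>\<^sup>+\<sigma>. \<integral>\<^sup>+\<epsilon>. \<integral>\<^sup>+\<rho>. K \<rho> \<sigma> * D \<tau> \<rho> \<sigma> * (w \<epsilon> * b \<epsilon> \<rho> \<sigma>) \<partial>lborel \<partial>lborel \<partial>lborel \<partial>lborel)"
      by (intro nn_integral_cong lborel_pair.Fubini') measurable
    also have "\<dots> = (\<integral>\<^sup>+\<tau>. \<integral>\<^sup>+\<sigma>. \<integral>\<^sup>+\<rho>. \<integral>\<^sup>+\<epsilon>. K \<rho> \<sigma> * D \<tau> \<rho> \<sigma> * (w \<epsilon> * b \<epsilon> \<rho> \<sigma>) \<partial>lborel \<partial>lborel \<partial>lborel \<partial>lborel)"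
      by (intro nn_integral_cong lborel_pair.Fubini') measurable
    also have "\<dots> = (\<integral>\<^sup>+\<tau>. \<integral>\<^sup>+\<sigma>. \<integral>\<^sup>+\<rho>. K \<rho> \<sigma> * D \<tau> \<rho> \<sigma> * (\<integral>\<^sup>+\<epsilon>. w \<epsilon> * b \<epsilon> \<rho> \<sigma> \<partial>lborel) \<partial>lborel \<partial>lborel \<partial>lborel)"
      by (intro nn_integral_cong nn_integral_cmult) measurable
    also have "\<dots> \<le> (\<integral>\<^sup>+\<tau>. \<integral>\<^sup>+\<sigma>. \<integral>\<^sup>+\<rho>. k * D \<tau> \<rho> \<sigma> * (\<mu> * w \<rho>) \<partial>lborel \<partial>lborel \<partial>lborel)"
      by (intro nn_integral_mono mult_mono K b order_refl) auto
    also have "\<dots> = (\<integral>\<^sup>+\<tau>. \<integral>\<^sup>+\<sigma>. \<integral>\<^sup>+\<rho>. k * \<mu> * (w \<rho> * D \<tau> \<rho> \<sigma>) \<partial>lborel \<partial>lborel \<partial>lborel)"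
      by (simp add: ac_simps)
    also have "\<dots> = k * \<mu> * ?I"
      by (subst nn_integral_cmult, measurable)+
    finally show ?thesis .
  qed
  have loss: "(\<integral>\<^sup>+\<epsilon>. w \<epsilon> * (\<integral>\<^sup>+\<tau>. \<integral>\<^sup>+\<rho>. K \<epsilon> \<rho> * D \<tau> \<epsilon> \<rho> \<partial>lborel \<partial>lborel) \<partial>lborel) \<le> k * ?I"
  proof -
    have "(\<integral>\<^sup>+\<epsilon>. w \<epsilon> * (\<integral>\<^sup>+\<tau>. \<integral>\<^sup>+\<rho>. K \<epsilon> \<rho> * D \<tau> \<epsilon> \<rho> \<partial>lborel \<partial>lborel) \<partial>lborel)
      \<le> (\<integral>\<^sup>+\<epsilon>. w \<epsilon> * (\<integral>\<^sup>+\<tau>. \<integral>\<^sup>+\<rho>. k * D \<tau> \<epsilon> \<rho> \<partial>lborel \<partial>lborel) \<partial>lborel)"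
      by (intro nn_integral_mono mult_mono K order_refl) auto
    also have "\<dots> = (\<integral>\<^sup>+\<epsilon>. \<integral>\<^sup>+\<tau>. \<integral>\<^sup>+\<rho>. k * (w \<epsilon> * D \<tau> \<epsilon> \<rho>) \<partial>lborel \<partial>lborel \<partial>lborel)"
      by (subst nn_integral_cmult[symmetric], measurable)+ (simp add: ac_simps)
    also have "\<dots> = (\<integral>\<^sup>+\<tau>. \<integral>\<^sup>+\<epsilon>. \<integral>\<^sup>+\<rho>. k * (w \<epsilon> * D \<tau> \<epsilon> \<rho>) \<partial>lborel \<partial>lborel \<partial>lborel)"
      by (rule lborel_pair.Fubini') measurable
    also have "\<dots> = (\<integral>\<^sup>+\<tau>. \<integral>\<^sup>+\<rho>. \<integral>\<^sup>+\<epsilon>. k * (w \<epsilon> * D \<tau> \<epsilon> \<rho>) \<partial>lborel \<partial>lborel \<partial>lborel)"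
      by (intro nn_integral_cong lborel_pair.Fubini') measurable
    \<comment> \<open>After the exchanges, \<open>\<epsilon>\<close> and \<open>\<rho>\<close> stand
      where \<open>?I\<close> has \<open>\<rho>\<close> and \<open>\<sigma>\<close>, so the
      integrals agree up to renaming bound variables.\<close>
    also have "\<dots> = k * ?I"
      by (subst nn_integral_cmult, measurable)+
    finally show ?thesis .
  qed
  have "?L = (\<integral>\<^sup>+\<epsilon>. w \<epsilon> * (\<integral>\<^sup>+\<tau>. \<integral>\<^sup>+\<sigma>. \<integral>\<^sup>+\<rho>. K \<rho> \<sigma> * b \<epsilon> \<rho> \<sigma> * D \<tau> \<rho> \<sigma> \<partial>lborel \<partial>lborel \<partial>lborel) \<partial>lborel)
     + (\<integral>\<^sup>+\<epsilon>. w \<epsilon> * (\<integral>\<^sup>+\<tau>. \<integral>\<^sup>+\<rho>. K \<epsilon> \<rho> * D \<tau> \<epsilon> \<rho> \<partial>lborel \<partial>lborel) \<partial>lborel)"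
    by (subst nn_integral_add[symmetric]) (auto simp: distrib_left)
  also have "\<dots> \<le> k * \<mu> * ?I + k * ?I"
    by (intro add_mono gain loss)
  finally show ?thesis
    by (simp add: algebra_simps)
qed

section \<open>Differences of iterated Bochner integrals\<close>

lemma ennreal_abs_integral_le:
  fixes f :: "'a \<Rightarrow> real"
  shows "ennreal \<bar>integral\<^sup>L M f\<bar> \<le> (\<integral>\<^sup>+x. ennreal \<bar>f x\<bar> \<partial>M)"
proof (cases "integrable M f")
  case True
  then show ?thesis
    using integral_norm_bound_ennreal[of M f] by simp
\<comment> \<open>The Bochner integral of a non-integrable function is \<open>0\<close>, which lies
  below any bound.\<close>
qed (simp add: not_integrable_integral_eq)

lemma ennreal_abs_integral_diff_le:
  fixes f g :: "'a \<Rightarrow> real"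
  assumes "integrable M f" "integrable M g"
  shows "ennreal \<bar>integral\<^sup>L M f - integral\<^sup>L M g\<bar> \<le> (\<integral>\<^sup>+x. ennreal \<bar>f x - g x\<bar> \<partial>M)"
  using ennreal_abs_integral_le[of M "\<lambda>x. f x - g x"] assms by simp

lemma AE_integrable_of_iterated_nn_integral:
  fixes F :: "'a \<Rightarrow> 'b \<Rightarrow> real"
  assumes "sigma_finite_measure N"
    and [measurable]: "(\<lambda>(x, y). F x y) \<in> borel_measurable (M \<Otimes>\<^sub>M N)"
    and fin: "(\<integral>\<^sup>+x. \<integral>\<^sup>+y. ennreal \<bar>F x y\<bar> \<partial>N \<partial>M) < \<infinity>"
  shows "AE x in M. integrable N (F x)"
proof -
  interpret N: sigma_finite_measure N by fact
  have "AE x in M. (\<integral>\<^sup>+y. ennreal \<bar>F x y\<bar> \<partial>N) \<noteq> \<infinity>"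
    using fin by (intro nn_integral_PInf_AE) auto
  then show ?thesis
    \<comment> \<open>The section \<open>F x\<close> is known to be measurable only for
      \<open>x\<close> in the space of \<open>M\<close>.\<close>
    using AE_space by eventually_elim (auto simp: integrable_iff_bounded less_top)
qed

lemma integrable_integral_of_iterated_nn_integral:
  fixes F :: "'a \<Rightarrow> 'b \<Rightarrow> real"
  assumes "sigma_finite_measure N"
    and [measurable]: "(\<lambda>(x, y). F x y) \<in> borel_measurable (M \<Otimes>\<^sub>M N)"
    and fin: "(\<integral>\<^sup>+x. \<integral>\<^sup>+y. ennreal \<bar>F x y\<bar> \<partial>N \<partial>M) < \<infinity>"
  shows "integrable M (\<lambda>x. LINT y|N. F x y)"
proof -
  interpret N: sigma_finite_measure N by fact
  have "(\<integral>\<^sup>+x. ennreal \<bar>LINT y|N. F x y\<bar> \<partial>M) \<le> (\<integral>\<^sup>+x. \<integral>\<^sup>+y. ennreal \<bar>F x y\<bar> \<partial>N \<partial>M)"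
    by (intro nn_integral_mono ennreal_abs_integral_le)
  with fin show ?thesis
    by (auto simp: integrable_iff_bounded)
qed

text \<open>The subtraction is carried inwards through two layers. The inner integrals are
  integrable as functions of \<open>x\<close>, which settles the outer layer; the sections are
  integrable for almost every \<open>x\<close>, which suffices under the outer integral.\<close>

lemma ennreal_abs_iterated_integral_diff_le:
  fixes F G :: "'a \<Rightarrow> 'b \<Rightarrow> real"
  assumes N: "sigma_finite_measure N"
    and F: "(\<lambda>(x, y). F x y) \<in> borel_measurable (M \<Otimes>\<^sub>M N)"
      "(\<integral>\<^sup>+x. \<integral>\<^sup>+y. ennreal \<bar>F x y\<bar> \<partial>N \<partial>M) < \<infinity>"
    and G: "(\<lambda>(x, y). G x y) \<in> borel_measurable (M \<Otimes>\<^sub>M N)"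
      "(\<integral>\<^sup>+x. \<integral>\<^sup>+y. ennreal \<bar>G x y\<bar> \<partial>N \<partial>M) < \<infinity>"
  shows "ennreal \<bar>(LINT x|M. LINT y|N. F x y) - (LINT x|M. LINT y|N. G x y)\<bar>
    \<le> (\<integral>\<^sup>+x. \<integral>\<^sup>+y. ennreal \<bar>F x y - G x y\<bar> \<partial>N \<partial>M)"
proof -
  have "ennreal \<bar>(LINT x|M. LINT y|N. F x y) - (LINT x|M. LINT y|N. G x y)\<bar>
    \<le> (\<integral>\<^sup>+x. ennreal \<bar>(LINT y|N. F x y) - (LINT y|N. G x y)\<bar> \<partial>M)"
    by (intro ennreal_abs_integral_diff_le integrable_integral_of_iterated_nn_integral N F G)
  also have "\<dots> \<le> (\<integral>\<^sup>+x. \<integral>\<^sup>+y. ennreal \<bar>F x y - G x y\<bar> \<partial>N \<partial>M)"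
    using AE_integrable_of_iterated_nn_integral[OF N F] AE_integrable_of_iterated_nn_integral[OF N G]
  proof (intro nn_integral_mono_AE, eventually_elim)
    case (elim x)
    then show ?case
      by (auto intro: ennreal_abs_integral_diff_le)
  qed
  finally show ?thesis .
qed

text \<open>At a fixed size \<open>\<epsilon>\<close>, \<open>F\<close> and \<open>G\<close> stand
  for the gain integrands of two functions, \<open>P\<close> and \<open>Q\<close> for their loss
  integrands. Linearity of the Bochner integral requires integrability at every layer; the four
  finite absolute integrals supply it, almost everywhere in the inner layers.\<close>

lemma ennreal_abs_breakage_diff_le:
  fixes F G :: "real \<Rightarrow> real \<Rightarrow> real \<Rightarrow> real" and P Q :: "real \<Rightarrow> real \<Rightarrow> real"
  assumes F: "(\<lambda>(\<tau>, \<sigma>, \<rho>). F \<tau> \<sigma> \<rho>) \<in> borel_measurable (borel \<Otimes>\<^sub>M borel \<Otimes>\<^sub>M borel)"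
      "(\<integral>\<^sup>+\<tau>. \<integral>\<^sup>+\<sigma>. \<integral>\<^sup>+\<rho>. ennreal \<bar>F \<tau> \<sigma> \<rho>\<bar> \<partial>lborel \<partial>lborel \<partial>lborel) < \<infinity>"
    and G: "(\<lambda>(\<tau>, \<sigma>, \<rho>). G \<tau> \<sigma> \<rho>) \<in> borel_measurable (borel \<Otimes>\<^sub>M borel \<Otimes>\<^sub>M borel)"
      "(\<integral>\<^sup>+\<tau>. \<integral>\<^sup>+\<sigma>. \<integral>\<^sup>+\<rho>. ennreal \<bar>G \<tau> \<sigma> \<rho>\<bar> \<partial>lborel \<partial>lborel \<partial>lborel) < \<infinity>"
    and P: "(\<lambda>(\<tau>, \<rho>). P \<tau> \<rho>) \<in> borel_measurable (borel \<Otimes>\<^sub>M borel)"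
      "(\<integral>\<^sup>+\<tau>. \<integral>\<^sup>+\<rho>. ennreal \<bar>P \<tau> \<rho>\<bar> \<partial>lborel \<partial>lborel) < \<infinity>"
    and Q: "(\<lambda>(\<tau>, \<rho>). Q \<tau> \<rho>) \<in> borel_measurable (borel \<Otimes>\<^sub>M borel)"
      "(\<integral>\<^sup>+\<tau>. \<integral>\<^sup>+\<rho>. ennreal \<bar>Q \<tau> \<rho>\<bar> \<partial>lborel \<partial>lborel) < \<infinity>"
  shows "ennreal \<bar>(LINT \<tau>|lborel. (LINT \<sigma>|lborel. LINT \<rho>|lborel. F \<tau> \<sigma> \<rho>) - (LINT \<rho>|lborel. P \<tau> \<rho>))
      - (LINT \<tau>|lborel. (LINT \<sigma>|lborel. LINT \<rho>|lborel. G \<tau> \<sigma> \<rho>) - (LINT \<rho>|lborel. Q \<tau> \<rho>))\<bar>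
    \<le> (\<integral>\<^sup>+\<tau>. \<integral>\<^sup>+\<sigma>. \<integral>\<^sup>+\<rho>. ennreal \<bar>F \<tau> \<sigma> \<rho> - G \<tau> \<sigma> \<rho>\<bar> \<partial>lborel \<partial>lborel \<partial>lborel)
      + (\<integral>\<^sup>+\<tau>. \<integral>\<^sup>+\<rho>. ennreal \<bar>P \<tau> \<rho> - Q \<tau> \<rho>\<bar> \<partial>lborel \<partial>lborel)"
proof -
  note [measurable] = borel_measurable_curried3[OF F(1)] borel_measurable_curried3[OF G(1)]
    borel_measurable_curried2[OF P(1)] borel_measurable_curried2[OF Q(1)]
  note sf = lborel.sigma_finite_measure_axioms
  define gain where "gain H \<tau> = (LINT \<sigma>|lborel. LINT \<rho>|lborel. H \<tau> \<sigma> \<rho>)"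
    for H :: "real \<Rightarrow> real \<Rightarrow> real \<Rightarrow> real" and \<tau>
  define loss where "loss H \<tau> = (LINT \<rho>|lborel. H \<tau> \<rho>)"
    for H :: "real \<Rightarrow> real \<Rightarrow> real" and \<tau>
  have gain: "integrable lborel (gain H)"
      "AE \<tau> in lborel. (\<integral>\<^sup>+\<sigma>. \<integral>\<^sup>+\<rho>. ennreal \<bar>H \<tau> \<sigma> \<rho>\<bar> \<partial>lborel \<partial>lborel) < \<infinity>"
    if H: "(\<lambda>(\<tau>, \<sigma>, \<rho>). H \<tau> \<sigma> \<rho>) \<in> borel_measurable (borel \<Otimes>\<^sub>M borel \<Otimes>\<^sub>M borel)"
      and fin: "(\<integral>\<^sup>+\<tau>. \<integral>\<^sup>+\<sigma>. \<integral>\<^sup>+\<rho>. ennreal \<bar>H \<tau> \<sigma> \<rho>\<bar> \<partial>lborel \<partial>lborel \<partial>lborel) < \<infinity>" for H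
  proof -
    note [measurable] = borel_measurable_curried3[OF H]
    have "(\<integral>\<^sup>+\<tau>. ennreal \<bar>gain H \<tau>\<bar> \<partial>lborel)
      \<le> (\<integral>\<^sup>+\<tau>. \<integral>\<^sup>+\<sigma>. \<integral>\<^sup>+\<rho>. ennreal \<bar>H \<tau> \<sigma> \<rho>\<bar> \<partial>lborel \<partial>lborel \<partial>lborel)"
      unfolding gain_def
      by (intro nn_integral_mono order_trans[OF ennreal_abs_integral_le] ennreal_abs_integral_le)
    with fin show "integrable lborel (gain H)"
      unfolding integrable_iff_bounded by (simp add: gain_def[abs_def])
    have "AE \<tau> in lborel. (\<integral>\<^sup>+\<sigma>. \<integral>\<^sup>+\<rho>. ennreal \<bar>H \<tau> \<sigma> \<rho>\<bar> \<partial>lborel \<partial>lborel) \<noteq> \<infinity>"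
      using fin by (intro nn_integral_PInf_AE) auto
    then show "AE \<tau> in lborel. (\<integral>\<^sup>+\<sigma>. \<integral>\<^sup>+\<rho>. ennreal \<bar>H \<tau> \<sigma> \<rho>\<bar> \<partial>lborel \<partial>lborel) < \<infinity>"
      by (simp add: less_top)
  qed
  have loss: "integrable lborel (loss P)" "integrable lborel (loss Q)"
    unfolding loss_def using P Q by (auto intro!: integrable_integral_of_iterated_nn_integral sf)
  have AE_loss: "AE \<tau> in lborel. integrable lborel (P \<tau>)" "AE \<tau> in lborel. integrable lborel (Q \<tau>)"
    using P Q by (auto intro!: AE_integrable_of_iterated_nn_integral sf)
  \<comment> \<open>Each of the four functions of time is integrable, so the two time integrals
    merge into one before the absolute value is taken inside.\<close>
  have "(LINT \<tau>|lborel. gain F \<tau> - loss P \<tau>) - (LINT \<tau>|lborel. gain G \<tau> - loss Q \<tau>)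
      = (LINT \<tau>|lborel. gain F \<tau> - loss P \<tau> - (gain G \<tau> - loss Q \<tau>))"
    using gain(1)[OF F] gain(1)[OF G] loss by (intro Bochner_Integration.integral_diff[symmetric]) auto
  then have "ennreal \<bar>(LINT \<tau>|lborel. gain F \<tau> - loss P \<tau>) - (LINT \<tau>|lborel. gain G \<tau> - loss Q \<tau>)\<bar>
      \<le> (\<integral>\<^sup>+\<tau>. ennreal \<bar>gain F \<tau> - loss P \<tau> - (gain G \<tau> - loss Q \<tau>)\<bar> \<partial>lborel)"
    by (metis ennreal_abs_integral_le)
  also have "\<dots> \<le> (\<integral>\<^sup>+\<tau>. (\<integral>\<^sup>+\<sigma>. \<integral>\<^sup>+\<rho>. ennreal \<bar>F \<tau> \<sigma> \<rho> - G \<tau> \<sigma> \<rho>\<bar> \<partial>lborel \<partial>lborel)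
      + (\<integral>\<^sup>+\<rho>. ennreal \<bar>P \<tau> \<rho> - Q \<tau> \<rho>\<bar> \<partial>lborel) \<partial>lborel)"
  proof (intro nn_integral_mono_AE)
    show "AE \<tau> in lborel. ennreal \<bar>gain F \<tau> - loss P \<tau> - (gain G \<tau> - loss Q \<tau>)\<bar>
      \<le> (\<integral>\<^sup>+\<sigma>. \<integral>\<^sup>+\<rho>. ennreal \<bar>F \<tau> \<sigma> \<rho> - G \<tau> \<sigma> \<rho>\<bar> \<partial>lborel \<partial>lborel)
        + (\<integral>\<^sup>+\<rho>. ennreal \<bar>P \<tau> \<rho> - Q \<tau> \<rho>\<bar> \<partial>lborel)"
      using gain(2)[OF F] gain(2)[OF G] AE_loss
    proof eventually_elim
      case (elim \<tau>)
      have "ennreal \<bar>gain F \<tau> - loss P \<tau> - (gain G \<tau> - loss Q \<tau>)\<bar>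
          \<le> ennreal \<bar>gain F \<tau> - gain G \<tau>\<bar> + ennreal \<bar>loss P \<tau> - loss Q \<tau>\<bar>"
        by (auto intro!: ennreal_leI simp flip: ennreal_plus)
      also have "\<dots> \<le> (\<integral>\<^sup>+\<sigma>. \<integral>\<^sup>+\<rho>. ennreal \<bar>F \<tau> \<sigma> \<rho> - G \<tau> \<sigma> \<rho>\<bar> \<partial>lborel \<partial>lborel)
        + (\<integral>\<^sup>+\<rho>. ennreal \<bar>P \<tau> \<rho> - Q \<tau> \<rho>\<bar> \<partial>lborel)"
        unfolding gain_def loss_def using elim
        by (intro add_mono ennreal_abs_iterated_integral_diff_le ennreal_abs_integral_diff_le sf) auto
      finally show ?case .
    qed
  qed
  also have "\<dots> = (\<integral>\<^sup>+\<tau>. \<integral>\<^sup>+\<sigma>. \<integral>\<^sup>+\<rho>. ennreal \<bar>F \<tau> \<sigma> \<rho> - G \<tau> \<sigma> \<rho>\<bar> \<partial>lborel \<partial>lborel \<partial>lborel)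
      + (\<integral>\<^sup>+\<tau>. \<integral>\<^sup>+\<rho>. ennreal \<bar>P \<tau> \<rho> - Q \<tau> \<rho>\<bar> \<partial>lborel \<partial>lborel)"
    by (rule nn_integral_add) measurable
  finally show ?thesis
    unfolding gain_def loss_def .
qed

text \<open>In \<open>B\<close> every integral runs over the whole line; the actual domains will be
  encoded as zeros of \<open>K\<close>, \<open>b\<close> and the functions. The finite weighted
  integrals of the products of \<open>u\<close> and of \<open>v\<close> ensure that
  \<open>B u \<epsilon>\<close> and \<open>B v \<epsilon>\<close> are genuine convergent integrals
  for almost every \<open>\<epsilon>\<close> with \<open>w \<epsilon> \<noteq> 0\<close>.\<close>

lemma nn_integral_breakage_diff_le:
  fixes w :: "real \<Rightarrow> ennreal" and K u v :: "real \<Rightarrow> real \<Rightarrow> real"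
    and b :: "real \<Rightarrow> real \<Rightarrow> real \<Rightarrow> real"
  defines "B h \<epsilon> \<equiv> LINT \<tau>|lborel.
      (LINT \<sigma>|lborel. LINT \<rho>|lborel. K \<rho> \<sigma> * b \<epsilon> \<rho> \<sigma> * h \<tau> \<rho> * h \<tau> \<sigma>)
      - (LINT \<rho>|lborel. K \<epsilon> \<rho> * h \<tau> \<epsilon> * h \<tau> \<rho>)"
  assumes [measurable]: "w \<in> borel_measurable borel"
    and meas: "(\<lambda>(\<rho>, \<sigma>). K \<rho> \<sigma>) \<in> borel_measurable (borel \<Otimes>\<^sub>M borel)"
      "(\<lambda>(\<epsilon>, \<rho>, \<sigma>). b \<epsilon> \<rho> \<sigma>) \<in> borel_measurable (borel \<Otimes>\<^sub>M borel \<Otimes>\<^sub>M borel)"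
      "(\<lambda>(\<tau>, \<rho>). u \<tau> \<rho>) \<in> borel_measurable (borel \<Otimes>\<^sub>M borel)"
      "(\<lambda>(\<tau>, \<rho>). v \<tau> \<rho>) \<in> borel_measurable (borel \<Otimes>\<^sub>M borel)"
    and K0: "\<And>\<rho> \<sigma>. 0 \<le> K \<rho> \<sigma>" and b0: "\<And>\<epsilon> \<rho> \<sigma>. 0 \<le> b \<epsilon> \<rho> \<sigma>"
    and K: "\<And>\<rho> \<sigma>. ennreal (K \<rho> \<sigma>) \<le> k"
    and b: "\<And>\<rho> \<sigma>. (\<integral>\<^sup>+\<epsilon>. w \<epsilon> * ennreal (b \<epsilon> \<rho> \<sigma>) \<partial>lborel) \<le> \<mu> * w \<rho>"
    and k: "k < \<infinity>" and \<mu>: "\<mu> < \<infinity>"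
    and u: "(\<integral>\<^sup>+\<tau>. \<integral>\<^sup>+\<sigma>. \<integral>\<^sup>+\<rho>. w \<rho> * ennreal \<bar>u \<tau> \<rho> * u \<tau> \<sigma>\<bar> \<partial>lborel \<partial>lborel \<partial>lborel) < \<infinity>"
    and v: "(\<integral>\<^sup>+\<tau>. \<integral>\<^sup>+\<sigma>. \<integral>\<^sup>+\<rho>. w \<rho> * ennreal \<bar>v \<tau> \<rho> * v \<tau> \<sigma>\<bar> \<partial>lborel \<partial>lborel \<partial>lborel) < \<infinity>"
  shows "(\<integral>\<^sup>+\<epsilon>. w \<epsilon> * ennreal \<bar>B u \<epsilon> - B v \<epsilon>\<bar> \<partial>lborel) \<le> k * (\<mu> + 1) *
    (\<integral>\<^sup>+\<tau>. \<integral>\<^sup>+\<sigma>. \<integral>\<^sup>+\<rho>. w \<rho> * ennreal \<bar>u \<tau> \<rho> * u \<tau> \<sigma> - v \<tau> \<rho> * v \<tau> \<sigma>\<bar> \<partial>lborel \<partial>lborel \<partial>lborel)"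
proof -
  note [measurable] = borel_measurable_curried2[OF meas(1)] borel_measurable_curried3[OF meas(2)]
    borel_measurable_curried2[OF meas(3)] borel_measurable_curried2[OF meas(4)]
  define G where "G D \<epsilon> = (\<integral>\<^sup>+\<tau>. \<integral>\<^sup>+\<sigma>. \<integral>\<^sup>+\<rho>. ennreal (K \<rho> \<sigma>) * ennreal (b \<epsilon> \<rho> \<sigma>) * ennreal \<bar>D \<tau> \<rho> \<sigma>\<bar> \<partial>lborel \<partial>lborel \<partial>lborel)"
    for D :: "real \<Rightarrow> real \<Rightarrow> real \<Rightarrow> real" and \<epsilon>
  define L where "L D \<epsilon> = (\<integral>\<^sup>+\<tau>. \<integral>\<^sup>+\<rho>. ennreal (K \<epsilon> \<rho>) * ennreal \<bar>D \<tau> \<epsilon> \<rho>\<bar> \<partial>lborel \<partial>lborel)"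
    for D :: "real \<Rightarrow> real \<Rightarrow> real \<Rightarrow> real" and \<epsilon>
  \<comment> \<open>The quadratic operator depends on \<open>h\<close> only through this tensor
    square, and formally in a linear way. Applying \<open>G\<close> and \<open>L\<close> to
    \<open>sq u\<close> and \<open>sq v\<close> gives convergence, applying them to the difference
    gives the Lipschitz estimate.\<close>
  define sq where "sq h \<tau> \<rho> \<sigma> = h \<tau> \<rho> * h \<tau> \<sigma>" for h :: "real \<Rightarrow> real \<Rightarrow> real" and \<tau> \<rho> \<sigma>
  have sq_measurable[measurable]: "(\<lambda>(\<tau>, \<rho>, \<sigma>). sq u \<tau> \<rho> \<sigma>) \<in> borel_measurable (borel \<Otimes>\<^sub>M borel \<Otimes>\<^sub>M borel)"
    "(\<lambda>(\<tau>, \<rho>, \<sigma>). sq v \<tau> \<rho> \<sigma>) \<in> borel_measurable (borel \<Otimes>\<^sub>M borel \<Otimes>\<^sub>M borel)"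
    unfolding sq_def by measurable
  have GL: "(\<integral>\<^sup>+\<epsilon>. w \<epsilon> * (G D \<epsilon> + L D \<epsilon>) \<partial>lborel)
      \<le> k * (\<mu> + 1) * (\<integral>\<^sup>+\<tau>. \<integral>\<^sup>+\<sigma>. \<integral>\<^sup>+\<rho>. w \<rho> * ennreal \<bar>D \<tau> \<rho> \<sigma>\<bar> \<partial>lborel \<partial>lborel \<partial>lborel)"
    if D: "(\<lambda>(\<tau>, \<rho>, \<sigma>). D \<tau> \<rho> \<sigma>) \<in> borel_measurable (borel \<Otimes>\<^sub>M borel \<Otimes>\<^sub>M borel)" for D
  proof -
    note [measurable] = borel_measurable_curried3[OF D]
    show ?thesis
      unfolding G_def L_def by (intro nn_integral_breakage_le K b) measurable
  qed
  have AE_fin: "AE \<epsilon> in lborel. w \<epsilon> * (G D \<epsilon> + L D \<epsilon>) \<noteq> \<infinity>"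
    if D: "(\<lambda>(\<tau>, \<rho>, \<sigma>). D \<tau> \<rho> \<sigma>) \<in> borel_measurable (borel \<Otimes>\<^sub>M borel \<Otimes>\<^sub>M borel)"
      and fin: "(\<integral>\<^sup>+\<tau>. \<integral>\<^sup>+\<sigma>. \<integral>\<^sup>+\<rho>. w \<rho> * ennreal \<bar>D \<tau> \<rho> \<sigma>\<bar> \<partial>lborel \<partial>lborel \<partial>lborel) < \<infinity>" for D
  proof (rule nn_integral_PInf_AE)
    note [measurable] = borel_measurable_curried3[OF D]
    show "(\<lambda>\<epsilon>. w \<epsilon> * (G D \<epsilon> + L D \<epsilon>)) \<in> borel_measurable lborel"
      unfolding G_def L_def by measurable
    have "k * (\<mu> + 1) * (\<integral>\<^sup>+\<tau>. \<integral>\<^sup>+\<sigma>. \<integral>\<^sup>+\<rho>. w \<rho> * ennreal \<bar>D \<tau> \<rho> \<sigma>\<bar> \<partial>lborel \<partial>lborel \<partial>lborel) < \<infinity>"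
      using k \<mu> fin by (auto simp: ennreal_mult_less_top)
    then show "(\<integral>\<^sup>+\<epsilon>. w \<epsilon> * (G D \<epsilon> + L D \<epsilon>) \<partial>lborel) \<noteq> \<infinity>"
      using GL[OF D] by auto
  qed
  have "(\<integral>\<^sup>+\<epsilon>. w \<epsilon> * ennreal \<bar>B u \<epsilon> - B v \<epsilon>\<bar> \<partial>lborel)
    \<le> (\<integral>\<^sup>+\<epsilon>. w \<epsilon> * (G (\<lambda>\<tau> \<rho> \<sigma>. sq u \<tau> \<rho> \<sigma> - sq v \<tau> \<rho> \<sigma>) \<epsilon>
        + L (\<lambda>\<tau> \<rho> \<sigma>. sq u \<tau> \<rho> \<sigma> - sq v \<tau> \<rho> \<sigma>) \<epsilon>) \<partial>lborel)"
  proof (rule nn_integral_mono_AE)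
    have "AE \<epsilon> in lborel. w \<epsilon> * (G (sq u) \<epsilon> + L (sq u) \<epsilon>) \<noteq> \<infinity>"
      "AE \<epsilon> in lborel. w \<epsilon> * (G (sq v) \<epsilon> + L (sq v) \<epsilon>) \<noteq> \<infinity>"
      by (rule AE_fin[OF sq_measurable(1) u[folded sq_def]] AE_fin[OF sq_measurable(2) v[folded sq_def]])+
    then show "AE \<epsilon> in lborel. w \<epsilon> * ennreal \<bar>B u \<epsilon> - B v \<epsilon>\<bar>
        \<le> w \<epsilon> * (G (\<lambda>\<tau> \<rho> \<sigma>. sq u \<tau> \<rho> \<sigma> - sq v \<tau> \<rho> \<sigma>) \<epsilon>
          + L (\<lambda>\<tau> \<rho> \<sigma>. sq u \<tau> \<rho> \<sigma> - sq v \<tau> \<rho> \<sigma>) \<epsilon>)"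
    proof eventually_elim
      case (elim \<epsilon>)
      show ?case
      \<comment> \<open>Where the weight vanishes, both sides are \<open>0\<close>. Elsewhere a
        nonzero factor times infinity is infinity in \<open>ennreal\<close>, so finiteness of the
        weighted sum forces \<open>G\<close> and \<open>L\<close> to be finite.\<close>
      proof (cases "w \<epsilon> = 0")
        case False
        then have fin: "G (sq u) \<epsilon> < \<infinity>" "L (sq u) \<epsilon> < \<infinity>" "G (sq v) \<epsilon> < \<infinity>" "L (sq v) \<epsilon> < \<infinity>"
          using elim by (auto simp: ennreal_mult_eq_top_iff less_top)
        have G_eq: "G D \<epsilon> = (\<integral>\<^sup>+\<tau>. \<integral>\<^sup>+\<sigma>. \<integral>\<^sup>+\<rho>. ennreal \<bar>K \<rho> \<sigma> * b \<epsilon> \<rho> \<sigma> * D \<tau> \<rho> \<sigma>\<bar> \<partial>lborel \<partial>lborel \<partial>lborel)"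
          and L_eq: "L D \<epsilon> = (\<integral>\<^sup>+\<tau>. \<integral>\<^sup>+\<rho>. ennreal \<bar>K \<epsilon> \<rho> * D \<tau> \<epsilon> \<rho>\<bar> \<partial>lborel \<partial>lborel)" for D
          by (simp_all add: G_def L_def abs_mult ennreal_mult K0 b0)
        have B_eq: "B h \<epsilon> = (LINT \<tau>|lborel.
            (LINT \<sigma>|lborel. LINT \<rho>|lborel. K \<rho> \<sigma> * b \<epsilon> \<rho> \<sigma> * sq h \<tau> \<rho> \<sigma>)
            - (LINT \<rho>|lborel. K \<epsilon> \<rho> * sq h \<tau> \<epsilon> \<rho>))" for h
          by (simp add: B_def sq_def mult.assoc)
        have "ennreal \<bar>B u \<epsilon> - B v \<epsilon>\<bar> \<le> G (\<lambda>\<tau> \<rho> \<sigma>. sq u \<tau> \<rho> \<sigma> - sq v \<tau> \<rho> \<sigma>) \<epsilon>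
          + L (\<lambda>\<tau> \<rho> \<sigma>. sq u \<tau> \<rho> \<sigma> - sq v \<tau> \<rho> \<sigma>) \<epsilon>"
          unfolding B_eq G_eq L_eq right_diff_distrib
          by (intro ennreal_abs_breakage_diff_le fin[unfolded G_eq L_eq]) (unfold sq_def, measurable)
        then show ?thesis
          by (intro mult_left_mono) auto
      qed simp
    qed
  qed
  also have "\<dots> \<le> k * (\<mu> + 1) *
    (\<integral>\<^sup>+\<tau>. \<integral>\<^sup>+\<sigma>. \<integral>\<^sup>+\<rho>. w \<rho> * ennreal \<bar>sq u \<tau> \<rho> \<sigma> - sq v \<tau> \<rho> \<sigma>\<bar> \<partial>lborel \<partial>lborel \<partial>lborel)"
    by (rule GL) (unfold sq_def, measurable)
  finally show ?thesis
    by (simp add: sq_def)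
qed

text \<open>The splitting \<open>u \<rho> * u \<sigma> - v \<rho> * v \<sigma> = u \<rho> * (u
  \<sigma> - v \<sigma>) + (u \<rho> - v \<rho>) * v \<sigma>\<close> separates the variables, and
  each summand contributes \<open>l * d\<close>. The factor in \<open>\<sigma>\<close> carries no
  weight: \<open>1 \<le> w\<close> on the positive axis inserts one, and at the remaining points
  \<open>u\<close> and \<open>v\<close> vanish.\<close>

lemma nn_integral_product_diff_le:
  fixes w :: "real \<Rightarrow> ennreal" and u v :: "real \<Rightarrow> real"
  assumes [measurable]: "w \<in> borel_measurable borel" "u \<in> borel_measurable borel" "v \<in> borel_measurable borel"
    and w: "\<And>\<rho>. 0 < \<rho> \<Longrightarrow> 1 \<le> w \<rho>"
    and u0: "\<And>\<rho>. \<rho> \<le> 0 \<Longrightarrow> u \<rho> = 0" and v0: "\<And>\<rho>. \<rho> \<le> 0 \<Longrightarrow> v \<rho> = 0"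
    and u: "(\<integral>\<^sup>+\<rho>. w \<rho> * ennreal \<bar>u \<rho>\<bar> \<partial>lborel) \<le> l"
    and v: "(\<integral>\<^sup>+\<rho>. w \<rho> * ennreal \<bar>v \<rho>\<bar> \<partial>lborel) \<le> l"
    and d: "(\<integral>\<^sup>+\<rho>. w \<rho> * ennreal \<bar>u \<rho> - v \<rho>\<bar> \<partial>lborel) \<le> d"
  shows "(\<integral>\<^sup>+\<sigma>. \<integral>\<^sup>+\<rho>. w \<rho> * ennreal \<bar>u \<rho> * u \<sigma> - v \<rho> * v \<sigma>\<bar> \<partial>lborel \<partial>lborel) \<le> 2 * l * d"
proof -
  have le: "(\<integral>\<^sup>+\<rho>. ennreal \<bar>h \<rho>\<bar> \<partial>lborel) \<le> (\<integral>\<^sup>+\<rho>. w \<rho> * ennreal \<bar>h \<rho>\<bar> \<partial>lborel)"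
    if "\<And>\<rho>. \<rho> \<le> 0 \<Longrightarrow> h \<rho> = 0" for h :: "real \<Rightarrow> real"
  proof (rule nn_integral_mono)
    show "ennreal \<bar>h \<rho>\<bar> \<le> w \<rho> * ennreal \<bar>h \<rho>\<bar>" for \<rho>
      using that[of \<rho>] mult_right_mono[OF w, of \<rho> "ennreal \<bar>h \<rho>\<bar>"] by (cases "0 < \<rho>") auto
  qed
  have "(\<integral>\<^sup>+\<sigma>. \<integral>\<^sup>+\<rho>. w \<rho> * ennreal \<bar>u \<rho> * u \<sigma> - v \<rho> * v \<sigma>\<bar> \<partial>lborel \<partial>lborel)
    \<le> (\<integral>\<^sup>+\<sigma>. \<integral>\<^sup>+\<rho>. ennreal \<bar>u \<sigma> - v \<sigma>\<bar> * (w \<rho> * ennreal \<bar>u \<rho>\<bar>)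
        + ennreal \<bar>v \<sigma>\<bar> * (w \<rho> * ennreal \<bar>u \<rho> - v \<rho>\<bar>) \<partial>lborel \<partial>lborel)"
  proof (intro nn_integral_mono)
    fix \<rho> \<sigma> :: real
    have "\<bar>u \<rho> * u \<sigma> - v \<rho> * v \<sigma>\<bar> = \<bar>u \<rho> * (u \<sigma> - v \<sigma>) + (u \<rho> - v \<rho>) * v \<sigma>\<bar>"
      by (simp add: algebra_simps)
    also have "\<dots> \<le> \<bar>u \<sigma> - v \<sigma>\<bar> * \<bar>u \<rho>\<bar> + \<bar>v \<sigma>\<bar> * \<bar>u \<rho> - v \<rho>\<bar>"
      by (rule order_trans[OF abs_triangle_ineq]) (simp add: abs_mult mult.commute)
    finally have "ennreal \<bar>u \<rho> * u \<sigma> - v \<rho> * v \<sigma>\<bar>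
        \<le> ennreal \<bar>u \<sigma> - v \<sigma>\<bar> * ennreal \<bar>u \<rho>\<bar> + ennreal \<bar>v \<sigma>\<bar> * ennreal \<bar>u \<rho> - v \<rho>\<bar>"
      by (simp add: ennreal_leI flip: ennreal_plus ennreal_mult)
    from mult_left_mono[OF this, of "w \<rho>"]
    show "w \<rho> * ennreal \<bar>u \<rho> * u \<sigma> - v \<rho> * v \<sigma>\<bar> \<le> ennreal \<bar>u \<sigma> - v \<sigma>\<bar> * (w \<rho> * ennreal \<bar>u \<rho>\<bar>)
        + ennreal \<bar>v \<sigma>\<bar> * (w \<rho> * ennreal \<bar>u \<rho> - v \<rho>\<bar>)"
      by (simp add: distrib_left ac_simps)
  qed
  also have "\<dots> = (\<integral>\<^sup>+\<sigma>. ennreal \<bar>u \<sigma> - v \<sigma>\<bar> \<partial>lborel) * (\<integral>\<^sup>+\<rho>. w \<rho> * ennreal \<bar>u \<rho>\<bar> \<partial>lborel)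
      + (\<integral>\<^sup>+\<sigma>. ennreal \<bar>v \<sigma>\<bar> \<partial>lborel) * (\<integral>\<^sup>+\<rho>. w \<rho> * ennreal \<bar>u \<rho> - v \<rho>\<bar> \<partial>lborel)"
    by (simp add: nn_integral_add nn_integral_cmult nn_integral_multc)
  also have "\<dots> \<le> d * l + l * d"
    using u0 v0 by (intro add_mono mult_mono u v d order_trans[OF le]) auto
  also have "\<dots> = 2 * l * d"
    by (simp add: mult.commute mult.assoc flip: mult_2)
  finally show ?thesis .
qed

section \<open>The weight, the norm and the contraction estimate\<close>

definition breakage_weight :: "real \<Rightarrow> real \<Rightarrow> real \<Rightarrow> ennreal" where
  "breakage_weight r s \<epsilon> = ennreal (if 0 < \<epsilon> then \<epsilon> powr r + 1 / \<epsilon> powr (2 * s) else 0)"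

lemma breakage_weight_measurable [measurable]: "breakage_weight r s \<in> borel_measurable borel"
  unfolding breakage_weight_def[abs_def] by measurable

text \<open>The power \<open>\<epsilon> powr r\<close> alone reaches \<open>1\<close> for
  \<open>1 \<le> \<epsilon>\<close>, the singular term alone for \<open>\<epsilon> < 1\<close>. This
  is what makes the norm dominate the unweighted integral.\<close>

lemma breakage_weight_ge_1:
  assumes "0 \<le> r" "0 \<le> s" "0 < \<epsilon>"
  shows "1 \<le> breakage_weight r s \<epsilon>"
proof (cases "1 \<le> \<epsilon>")
  case True
  with assms show ?thesis
    using ge_one_powr_ge_zero[of \<epsilon> r] by (simp add: breakage_weight_def flip: ennreal_1) (auto intro!: ennreal_leI add_increasing2)
next
  case False
  with assms have "\<epsilon> powr (2 * s) \<le> 1"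
    using powr_le1[of "2 * s" \<epsilon>] by simp
  with assms have "1 \<le> 1 / \<epsilon> powr (2 * s)"
    by (simp add: field_simps)
  with assms show ?thesis
    by (simp add: breakage_weight_def flip: ennreal_1) (auto intro!: ennreal_leI add_increasing)
qed

text \<open>The cutoff built into the weight replaces the restriction of the integral to positive
  sizes, so that the whole-line estimates above apply to the norm.\<close>

lemma Ynorm_eq_SUP_weight:
  "Ynorm r s t f = (SUP \<tau>\<in>{0..t}. \<integral>\<^sup>+\<epsilon>. breakage_weight r s \<epsilon> * ennreal \<bar>f \<tau> \<epsilon>\<bar> \<partial>lborel)"
  unfolding Ynorm_def
  by (intro SUP_cong nn_integral_cong)
     (auto simp: breakage_weight_def indicator_def ennreal_mult)

lemma Ynorm_cong:
  assumes "\<And>\<tau> \<epsilon>. \<tau> \<in> {0..t} \<Longrightarrow> 0 < \<epsilon> \<Longrightarrow> f \<tau> \<epsilon> = g \<tau> \<epsilon>"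
  shows "Ynorm r s t f = Ynorm r s t g"
  unfolding Ynorm_def using assms
  by (intro SUP_cong nn_integral_cong) (auto simp: indicator_def)

lemma measurable_slice_of_continuous_on:
  fixes f :: "real \<Rightarrow> real \<Rightarrow> real"
  assumes "continuous_on ({0..t} \<times> {0<..}) (\<lambda>(\<tau>, \<epsilon>). f \<tau> \<epsilon>)" "\<tau> \<in> {0..t}"
  shows "(\<lambda>\<epsilon>. if 0 < \<epsilon> then f \<tau> \<epsilon> else 0) \<in> borel_measurable borel"
proof -
  have "continuous_on {0<..} (\<lambda>\<epsilon>. (\<tau>, \<epsilon>))"
    by (intro continuous_intros)
  then have "continuous_on {0<..} (\<lambda>\<epsilon>. f \<tau> \<epsilon>)"
    using continuous_on_compose2[OF assms(1), of "{0<..}" "\<lambda>\<epsilon>. (\<tau>, \<epsilon>)"] assms(2)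
    by (simp add: image_subset_iff)
  then have "(\<lambda>\<epsilon>. indicator {0<..} \<epsilon> *\<^sub>R f \<tau> \<epsilon>) \<in> borel_measurable borel"
    by (intro borel_measurable_continuous_on_indicator) auto
  then show ?thesis
    by (rule measurable_cong[THEN iffD1, rotated]) (auto simp: indicator_def)
qed

text \<open>Assuming pointwise domination makes this serve for differences as well as for sums.
  Continuity supplies measurable slices, on which additivity of the integral rests.\<close>

lemma Ynorm_add_le:
  assumes f: "continuous_on ({0..t} \<times> {0<..}) (\<lambda>(\<tau>, \<epsilon>). f \<tau> \<epsilon>)"
    and g: "continuous_on ({0..t} \<times> {0<..}) (\<lambda>(\<tau>, \<epsilon>). g \<tau> \<epsilon>)"
    and h: "\<And>\<tau> \<epsilon>. \<tau> \<in> {0..t} \<Longrightarrow> 0 < \<epsilon> \<Longrightarrow> \<bar>h \<tau> \<epsilon>\<bar> \<le> \<bar>f \<tau> \<epsilon>\<bar> + \<bar>g \<tau> \<epsilon>\<bar>"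
  shows "Ynorm r s t h \<le> Ynorm r s t f + Ynorm r s t g"
  unfolding Ynorm_eq_SUP_weight
proof (rule SUP_least)
  fix \<tau> assume \<tau>: "\<tau> \<in> {0..t}"
  let ?w = "breakage_weight r s"
  let ?f = "\<lambda>\<epsilon>. if 0 < \<epsilon> then f \<tau> \<epsilon> else 0" and ?g = "\<lambda>\<epsilon>. if 0 < \<epsilon> then g \<tau> \<epsilon> else 0"
  note [measurable] = measurable_slice_of_continuous_on[OF f \<tau>] measurable_slice_of_continuous_on[OF g \<tau>]
  have "(\<integral>\<^sup>+\<epsilon>. ?w \<epsilon> * ennreal \<bar>h \<tau> \<epsilon>\<bar> \<partial>lborel)
    \<le> (\<integral>\<^sup>+\<epsilon>. ?w \<epsilon> * ennreal \<bar>?f \<epsilon>\<bar> + ?w \<epsilon> * ennreal \<bar>?g \<epsilon>\<bar> \<partial>lborel)"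
  proof (rule nn_integral_mono)
    show "?w \<epsilon> * ennreal \<bar>h \<tau> \<epsilon>\<bar> \<le> ?w \<epsilon> * ennreal \<bar>?f \<epsilon>\<bar> + ?w \<epsilon> * ennreal \<bar>?g \<epsilon>\<bar>" for \<epsilon>
      using h[OF \<tau>, of \<epsilon>]
      by (cases "0 < \<epsilon>")
         (auto intro!: mult_left_mono ennreal_leI simp: breakage_weight_def simp flip: distrib_left ennreal_plus)
  qed
  also have "\<dots> = (\<integral>\<^sup>+\<epsilon>. ?w \<epsilon> * ennreal \<bar>?f \<epsilon>\<bar> \<partial>lborel) + (\<integral>\<^sup>+\<epsilon>. ?w \<epsilon> * ennreal \<bar>?g \<epsilon>\<bar> \<partial>lborel)"
    by (rule nn_integral_add) measurable
  also have "\<dots> = (\<integral>\<^sup>+\<epsilon>. ?w \<epsilon> * ennreal \<bar>f \<tau> \<epsilon>\<bar> \<partial>lborel) + (\<integral>\<^sup>+\<epsilon>. ?w \<epsilon> * ennreal \<bar>g \<tau> \<epsilon>\<bar> \<partial>lborel)"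
    by (intro arg_cong2[where f = "(+)"] nn_integral_cong) (auto simp: breakage_weight_def)
  also have "\<dots> \<le> (SUP \<tau>\<in>{0..t}. \<integral>\<^sup>+\<epsilon>. ?w \<epsilon> * ennreal \<bar>f \<tau> \<epsilon>\<bar> \<partial>lborel)
      + (SUP \<tau>\<in>{0..t}. \<integral>\<^sup>+\<epsilon>. ?w \<epsilon> * ennreal \<bar>g \<tau> \<epsilon>\<bar> \<partial>lborel)"
    using \<tau> by (intro add_mono SUP_upper)
  finally show "(\<integral>\<^sup>+\<epsilon>. ?w \<epsilon> * ennreal \<bar>h \<tau> \<epsilon>\<bar> \<partial>lborel) \<le> \<dots>" .
qed

text \<open>On the support \<open>\<epsilon> powr r \<le> \<rho> powr (r - 1) * \<epsilon>\<close>,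
  because \<open>1 \<le> r\<close>; the mass bound then turns the first part of the weight into
  \<open>\<rho> powr r\<close>. The singular part is bounded by hypothesis, and
  \<open>1 \<le> \<mu>\<close> allows a common factor.\<close>

lemma breakage_weight_moment_le:
  fixes b :: "real \<Rightarrow> real"
  assumes [measurable]: "b \<in> borel_measurable borel"
    and b0: "\<And>\<epsilon>. 0 \<le> b \<epsilon>" and supp: "\<And>\<epsilon>. \<not> (0 < \<epsilon> \<and> \<epsilon> < \<rho>) \<Longrightarrow> b \<epsilon> = 0"
    and \<rho>: "0 < \<rho>" and r: "1 \<le> r" and \<mu>: "1 \<le> \<mu>"
    and mass: "(\<integral>\<^sup>+\<epsilon>. ennreal (\<epsilon> * b \<epsilon>) \<partial>lborel) \<le> ennreal \<rho>"
    and sing: "(\<integral>\<^sup>+\<epsilon>. ennreal (\<epsilon> powr (- 2 * s) * b \<epsilon>) \<partial>lborel) \<le> ennreal (\<mu> * \<rho> powr (- 2 * s))"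
  shows "(\<integral>\<^sup>+\<epsilon>. breakage_weight r s \<epsilon> * ennreal (b \<epsilon>) \<partial>lborel) \<le> ennreal \<mu> * breakage_weight r s \<rho>"
proof -
  have "(\<integral>\<^sup>+\<epsilon>. breakage_weight r s \<epsilon> * ennreal (b \<epsilon>) \<partial>lborel)
    \<le> (\<integral>\<^sup>+\<epsilon>. ennreal (\<rho> powr (r - 1)) * ennreal (\<epsilon> * b \<epsilon>) + ennreal (\<epsilon> powr (- 2 * s) * b \<epsilon>) \<partial>lborel)"
  proof (rule nn_integral_mono)
    fix \<epsilon>
    show "breakage_weight r s \<epsilon> * ennreal (b \<epsilon>)
      \<le> ennreal (\<rho> powr (r - 1)) * ennreal (\<epsilon> * b \<epsilon>) + ennreal (\<epsilon> powr (- 2 * s) * b \<epsilon>)"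
    proof (cases "0 < \<epsilon> \<and> \<epsilon> < \<rho>")
      case True
      then have "\<epsilon> powr r = \<epsilon> powr (r - 1) * \<epsilon>"
        using powr_add[of \<epsilon> "r - 1" 1] by simp
      also have "\<dots> \<le> \<rho> powr (r - 1) * \<epsilon>"
        using True r by (intro mult_right_mono powr_mono2) auto
      finally have "\<epsilon> powr r \<le> \<rho> powr (r - 1) * \<epsilon>" .
      from mult_right_mono[OF this b0[of \<epsilon>]] have "(\<epsilon> powr r + 1 / \<epsilon> powr (2 * s)) * b \<epsilon>
          \<le> \<rho> powr (r - 1) * (\<epsilon> * b \<epsilon>) + \<epsilon> powr (- 2 * s) * b \<epsilon>"
        by (simp add: distrib_right powr_minus_divide mult.assoc)
      with True b0[of \<epsilon>] show ?thesis
        by (simp add: breakage_weight_def ennreal_leI flip: ennreal_mult ennreal_plus)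
    qed (simp add: supp)
  qed
  also have "\<dots> = ennreal (\<rho> powr (r - 1)) * (\<integral>\<^sup>+\<epsilon>. ennreal (\<epsilon> * b \<epsilon>) \<partial>lborel)
      + (\<integral>\<^sup>+\<epsilon>. ennreal (\<epsilon> powr (- 2 * s) * b \<epsilon>) \<partial>lborel)"
    by (simp add: nn_integral_add nn_integral_cmult)
  also have "\<dots> \<le> ennreal (\<rho> powr (r - 1)) * ennreal \<rho> + ennreal (\<mu> * \<rho> powr (- 2 * s))"
    by (intro add_mono mult_left_mono mass sing) auto
  also have "\<dots> = ennreal (\<rho> powr r + \<mu> * \<rho> powr (- 2 * s))"
    using \<rho> \<mu> powr_add[of \<rho> "r - 1" 1] by (simp flip: ennreal_mult ennreal_plus)
  also have "\<dots> \<le> ennreal (\<mu> * (\<rho> powr r + 1 / \<rho> powr (2 * s)))"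
    using \<mu> mult_right_mono[OF \<mu>, of "\<rho> powr r"]
    by (intro ennreal_leI) (simp add: distrib_left powr_minus_divide)
  also have "\<dots> = ennreal \<mu> * breakage_weight r s \<rho>"
    using \<rho> \<mu> by (simp add: breakage_weight_def ennreal_mult)
  finally show ?thesis .
qed

text \<open>The constant collects three estimates: \<open>k * (\<mu> + 1)\<close> from the kernels,
  \<open>2 * l\<close> from the difference of products on the ball of radius \<open>l\<close>, and
  \<open>t\<close> from the length of the time interval. The initial datum cancels in the
  difference.\<close>

lemma Ynorm_breakage_S_diff_le:
  fixes K u v :: "real \<Rightarrow> real \<Rightarrow> real" and b :: "real \<Rightarrow> real \<Rightarrow> real \<Rightarrow> real"
  assumes r: "1 \<le> r" and s: "0 \<le> s" and t: "0 \<le> t" and k: "0 \<le> k" and \<mu>: "0 \<le> \<mu>" and l: "0 \<le> l"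
    and K0: "\<And>\<rho> \<sigma>. 0 < \<rho> \<Longrightarrow> 0 < \<sigma> \<Longrightarrow> 0 \<le> K \<rho> \<sigma>"
    and K: "\<And>\<rho> \<sigma>. 0 < \<rho> \<Longrightarrow> 0 < \<sigma> \<Longrightarrow> K \<rho> \<sigma> \<le> k"
    and K_cont: "continuous_on ({0<..} \<times> {0<..}) (\<lambda>(\<rho>, \<sigma>). K \<rho> \<sigma>)"
    and b0: "\<And>\<epsilon> \<rho> \<sigma>. 0 < \<epsilon> \<Longrightarrow> 0 < \<rho> \<Longrightarrow> 0 < \<sigma> \<Longrightarrow> 0 \<le> b \<epsilon> \<rho> \<sigma>"
    and b_meas: "(\<lambda>(\<epsilon>, \<rho>, \<sigma>). if 0 < \<epsilon> \<and> \<epsilon> < \<rho> \<and> 0 < \<sigma> then b \<epsilon> \<rho> \<sigma> else 0)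
      \<in> borel_measurable (borel \<Otimes>\<^sub>M borel \<Otimes>\<^sub>M borel)"
    and b: "\<And>\<rho> \<sigma>. 0 < \<rho> \<Longrightarrow> 0 < \<sigma> \<Longrightarrow>
      (\<integral>\<^sup>+\<epsilon>. breakage_weight r s \<epsilon> * ennreal (if 0 < \<epsilon> \<and> \<epsilon> < \<rho> \<and> 0 < \<sigma> then b \<epsilon> \<rho> \<sigma> else 0) \<partial>lborel)
        \<le> ennreal \<mu> * breakage_weight r s \<rho>"
    and u_cont: "continuous_on ({0..t} \<times> {0<..}) (\<lambda>(\<tau>, \<epsilon>). u \<tau> \<epsilon>)"
    and v_cont: "continuous_on ({0..t} \<times> {0<..}) (\<lambda>(\<tau>, \<epsilon>). v \<tau> \<epsilon>)"
    and u: "Ynorm r s t u \<le> ennreal l" and v: "Ynorm r s t v \<le> ennreal l"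
  shows "Ynorm r s t (\<lambda>\<tau> \<epsilon>. breakage_S K b f_in u \<tau> \<epsilon> - breakage_S K b f_in v \<tau> \<epsilon>)
    \<le> ennreal (2 * t * k * (\<mu> + 1) * l) * Ynorm r s t (\<lambda>\<tau> \<epsilon>. u \<tau> \<epsilon> - v \<tau> \<epsilon>)"
  unfolding Ynorm_eq_SUP_weight[of r s t "\<lambda>\<tau> \<epsilon>. breakage_S K b f_in u \<tau> \<epsilon> - breakage_S K b f_in v \<tau> \<epsilon>"]
proof (rule SUP_least)
  fix a assume a: "a \<in> {0..t}"
  let ?w = "breakage_weight r s"
  \<comment> \<open>Three truncations encode the domains of integration: \<open>Kc\<close> keeps
    positive sizes, \<open>bc\<close> also keeps \<open>\<epsilon> < \<rho>\<close>, strict like the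
    open ray of the gain integral, and \<open>tr\<close> keeps times up to \<open>a\<close> and
    positive sizes.\<close>
  define Kc where "Kc \<rho> \<sigma> = (if 0 < \<rho> \<and> 0 < \<sigma> then K \<rho> \<sigma> else 0)" for \<rho> \<sigma>
  define bc where "bc \<epsilon> \<rho> \<sigma> = (if 0 < \<epsilon> \<and> \<epsilon> < \<rho> \<and> 0 < \<sigma> then b \<epsilon> \<rho> \<sigma> else 0)" for \<epsilon> \<rho> \<sigma>
  define tr where "tr h \<tau> \<epsilon> = (if \<tau> \<in> {0..a} \<and> 0 < \<epsilon> then h \<tau> \<epsilon> else 0)"
    for h :: "real \<Rightarrow> real \<Rightarrow> real" and \<tau> \<epsilon>
  define B where "B h \<epsilon> = (LINT \<tau>|lborel.
      (LINT \<sigma>|lborel. LINT \<rho>|lborel. Kc \<rho> \<sigma> * bc \<epsilon> \<rho> \<sigma> * tr h \<tau> \<rho> * tr h \<tau> \<sigma>)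
      - (LINT \<rho>|lborel. Kc \<epsilon> \<rho> * tr h \<tau> \<epsilon> * tr h \<tau> \<rho>))"
    for h :: "real \<Rightarrow> real \<Rightarrow> real" and \<epsilon>
  have N_eq: "breakage_N K b h a \<epsilon> = B h \<epsilon>" if \<epsilon>: "0 < \<epsilon>" for h \<epsilon>
    unfolding breakage_N_def B_def set_lebesgue_integral_def
  proof (rule Bochner_Integration.integral_cong[OF refl])
    fix \<tau> :: real
    show "indicator {0..a} \<tau> *\<^sub>R ((LINT \<sigma>|lborel. indicator {0<..} \<sigma> *\<^sub>R
          (LINT \<rho>|lborel. indicator {\<epsilon><..} \<rho> *\<^sub>R (K \<rho> \<sigma> * b \<epsilon> \<rho> \<sigma> * h \<tau> \<rho> * h \<tau> \<sigma>)))
        - (LINT \<rho>|lborel. indicator {0<..} \<rho> *\<^sub>R (K \<epsilon> \<rho> * h \<tau> \<epsilon> * h \<tau> \<rho>)))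
      = (LINT \<sigma>|lborel. LINT \<rho>|lborel. Kc \<rho> \<sigma> * bc \<epsilon> \<rho> \<sigma> * tr h \<tau> \<rho> * tr h \<tau> \<sigma>)
        - (LINT \<rho>|lborel. Kc \<epsilon> \<rho> * tr h \<tau> \<epsilon> * tr h \<tau> \<rho>)"
    proof (cases "\<tau> \<in> {0..a}")
      case True
      have "(LINT \<sigma>|lborel. indicator {0<..} \<sigma> *\<^sub>R
          (LINT \<rho>|lborel. indicator {\<epsilon><..} \<rho> *\<^sub>R (K \<rho> \<sigma> * b \<epsilon> \<rho> \<sigma> * h \<tau> \<rho> * h \<tau> \<sigma>)))
        = (LINT \<sigma>|lborel. LINT \<rho>|lborel. Kc \<rho> \<sigma> * bc \<epsilon> \<rho> \<sigma> * tr h \<tau> \<rho> * tr h \<tau> \<sigma>)"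
      proof (rule Bochner_Integration.integral_cong[OF refl])
        fix \<sigma> :: real
        show "indicator {0<..} \<sigma> *\<^sub>R
            (LINT \<rho>|lborel. indicator {\<epsilon><..} \<rho> *\<^sub>R (K \<rho> \<sigma> * b \<epsilon> \<rho> \<sigma> * h \<tau> \<rho> * h \<tau> \<sigma>))
          = (LINT \<rho>|lborel. Kc \<rho> \<sigma> * bc \<epsilon> \<rho> \<sigma> * tr h \<tau> \<rho> * tr h \<tau> \<sigma>)"
          \<comment> \<open>The indicator in \<open>\<sigma>\<close> is constant in
            \<open>\<rho>\<close> and enters the inner integral whether or not that integral
            converges.\<close>
          unfolding integral_scaleR_right[symmetric] using True \<epsilon>
          by (intro Bochner_Integration.integral_cong refl) (auto simp: indicator_def Kc_def bc_def tr_def)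
      qed
      moreover have "(LINT \<rho>|lborel. indicator {0<..} \<rho> *\<^sub>R (K \<epsilon> \<rho> * h \<tau> \<epsilon> * h \<tau> \<rho>))
        = (LINT \<rho>|lborel. Kc \<epsilon> \<rho> * tr h \<tau> \<epsilon> * tr h \<tau> \<rho>)"
        using True \<epsilon> by (intro Bochner_Integration.integral_cong refl) (auto simp: indicator_def Kc_def tr_def)
      ultimately show ?thesis
        using True by simp
    next
      case False
      then have "tr h \<tau> = (\<lambda>_. 0)"
        by (auto simp: tr_def)
      with False show ?thesis
        by simp
    qed
  qed
  have Kc_meas: "(\<lambda>(\<rho>, \<sigma>). Kc \<rho> \<sigma>) \<in> borel_measurable (borel \<Otimes>\<^sub>M borel)"
  proof -
    have "(\<lambda>z. indicator ({0<..} \<times> {0<..}) z *\<^sub>R (case z of (\<rho>, \<sigma>) \<Rightarrow> K \<rho> \<sigma>)) \<in> borel_measurable borel"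
      by (intro borel_measurable_continuous_on_indicator borel_Times K_cont) auto
    then show ?thesis
      unfolding borel_prod
      by (rule measurable_cong[THEN iffD1, rotated]) (auto simp: indicator_def Kc_def split: if_splits)
  qed
  have bc_meas: "(\<lambda>(\<epsilon>, \<rho>, \<sigma>). bc \<epsilon> \<rho> \<sigma>) \<in> borel_measurable (borel \<Otimes>\<^sub>M borel \<Otimes>\<^sub>M borel)"
    unfolding bc_def by (rule b_meas)
  have tr_meas: "(\<lambda>(\<tau>, \<epsilon>). tr h \<tau> \<epsilon>) \<in> borel_measurable (borel \<Otimes>\<^sub>M borel)"
    if "continuous_on ({0..t} \<times> {0<..}) (\<lambda>(\<tau>, \<epsilon>). h \<tau> \<epsilon>)" for h
  proof -
    have "continuous_on ({0..a} \<times> {0<..}) (\<lambda>(\<tau>, \<epsilon>). h \<tau> \<epsilon>)"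
      using that by (rule continuous_on_subset) (use a in auto)
    then have "(\<lambda>z. indicator ({0..a} \<times> {0<..}) z *\<^sub>R (case z of (\<tau>, \<epsilon>) \<Rightarrow> h \<tau> \<epsilon>)) \<in> borel_measurable borel"
      by (intro borel_measurable_continuous_on_indicator borel_Times) auto
    then show ?thesis
      unfolding borel_prod
      by (rule measurable_cong[THEN iffD1, rotated]) (auto simp: indicator_def tr_def split: if_splits)
  qed
  have slice_le: "(\<integral>\<^sup>+\<rho>. ?w \<rho> * ennreal \<bar>if 0 < \<rho> then h \<tau> \<rho> else 0\<bar> \<partial>lborel) \<le> Ynorm r s t h"
    if "\<tau> \<in> {0..a}" for h \<tau>
  proof -
    have "(\<integral>\<^sup>+\<rho>. ?w \<rho> * ennreal \<bar>if 0 < \<rho> then h \<tau> \<rho> else 0\<bar> \<partial>lborel)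
        = (\<integral>\<^sup>+\<rho>. ?w \<rho> * ennreal \<bar>h \<tau> \<rho>\<bar> \<partial>lborel)"
      by (intro nn_integral_cong) (auto simp: breakage_weight_def)
    also have "\<dots> \<le> Ynorm r s t h"
      unfolding Ynorm_eq_SUP_weight using that a by (intro SUP_upper) auto
    finally show ?thesis .
  qed
  \<comment> \<open>The distance is kept general in both arguments: the pair \<open>u\<close>,
    \<open>v\<close> gives the Lipschitz bound, and a function paired with zero gives
    finiteness.\<close>
  define d where "d g h = Ynorm r s t (\<lambda>\<tau> \<epsilon>. g \<tau> \<epsilon> - h \<tau> \<epsilon>)" for g h
  have product_le: "(\<integral>\<^sup>+\<tau>. \<integral>\<^sup>+\<sigma>. \<integral>\<^sup>+\<rho>. ?w \<rho> * ennreal \<bar>tr g \<tau> \<rho> * tr g \<tau> \<sigma> - tr h \<tau> \<rho> * tr h \<tau> \<sigma>\<bar> \<partial>lborel \<partial>lborel \<partial>lborel)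
      \<le> 2 * ennreal l * d g h * ennreal t"
    if g: "continuous_on ({0..t} \<times> {0<..}) (\<lambda>(\<tau>, \<epsilon>). g \<tau> \<epsilon>)" "Ynorm r s t g \<le> ennreal l"
      and h: "continuous_on ({0..t} \<times> {0<..}) (\<lambda>(\<tau>, \<epsilon>). h \<tau> \<epsilon>)" "Ynorm r s t h \<le> ennreal l" for g h
  proof -
    have "(\<integral>\<^sup>+\<tau>. \<integral>\<^sup>+\<sigma>. \<integral>\<^sup>+\<rho>. ?w \<rho> * ennreal \<bar>tr g \<tau> \<rho> * tr g \<tau> \<sigma> - tr h \<tau> \<rho> * tr h \<tau> \<sigma>\<bar> \<partial>lborel \<partial>lborel \<partial>lborel)
        \<le> (\<integral>\<^sup>+\<tau>. 2 * ennreal l * d g h * indicator {0..a} \<tau> \<partial>lborel)"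
    proof (rule nn_integral_mono)
      fix \<tau> :: real
      show "(\<integral>\<^sup>+\<sigma>. \<integral>\<^sup>+\<rho>. ?w \<rho> * ennreal \<bar>tr g \<tau> \<rho> * tr g \<tau> \<sigma> - tr h \<tau> \<rho> * tr h \<tau> \<sigma>\<bar> \<partial>lborel \<partial>lborel)
        \<le> 2 * ennreal l * d g h * indicator {0..a} \<tau>"
      proof (cases "\<tau> \<in> {0..a}")
        case True
        have tr_eq: "tr f \<tau> = (\<lambda>\<epsilon>. if 0 < \<epsilon> then f \<tau> \<epsilon> else 0)" for f
          using True by (auto simp: tr_def)
        have "\<tau> \<in> {0..t}"
          using True a by auto
        then have "(\<integral>\<^sup>+\<sigma>. \<integral>\<^sup>+\<rho>. ?w \<rho> * ennreal \<bar>tr g \<tau> \<rho> * tr g \<tau> \<sigma> - tr h \<tau> \<rho> * tr h \<tau> \<sigma>\<bar> \<partial>lborel \<partial>lborel)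
            \<le> 2 * ennreal l * d g h"
          unfolding tr_eq
        proof (intro nn_integral_product_diff_le g h
            measurable_slice_of_continuous_on[where t = t] breakage_weight_ge_1)
          have "(\<integral>\<^sup>+\<rho>. ?w \<rho> * ennreal \<bar>(if 0 < \<rho> then g \<tau> \<rho> else 0) - (if 0 < \<rho> then h \<tau> \<rho> else 0)\<bar> \<partial>lborel)
              = (\<integral>\<^sup>+\<rho>. ?w \<rho> * ennreal \<bar>if 0 < \<rho> then g \<tau> \<rho> - h \<tau> \<rho> else 0\<bar> \<partial>lborel)"
            by (intro nn_integral_cong) auto
          also have "\<dots> \<le> d g h"
            unfolding d_def using True by (rule slice_le)
          finally show "(\<integral>\<^sup>+\<rho>. ?w \<rho> * ennreal \<bar>(if 0 < \<rho> then g \<tau> \<rho> else 0) - (if 0 < \<rho> then h \<tau> \<rho> else 0)\<bar> \<partial>lborel)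
              \<le> d g h" .
        qed (use r s True in \<open>auto intro!: order_trans[OF slice_le g(2)] order_trans[OF slice_le h(2)]\<close>)
        with True show ?thesis
          by simp
      next
        case False
        then have "tr f \<tau> = (\<lambda>_. 0)" for f
          by (auto simp: tr_def)
        then show ?thesis
          by simp
      qed
    qed
    \<comment> \<open>The bound on each slice is uniform in time, so integrating over time only
      contributes the length \<open>a\<close>, which is at most \<open>t\<close>.\<close>
    also have "\<dots> = 2 * ennreal l * d g h * ennreal a"
      using a by (simp add: nn_integral_cmult_indicator)
    also have "\<dots> \<le> 2 * ennreal l * d g h * ennreal t"
      using a by (intro mult_left_mono ennreal_leI) auto
    finally show ?thesis .
  qed
  have fin: "(\<integral>\<^sup>+\<tau>. \<integral>\<^sup>+\<sigma>. \<integral>\<^sup>+\<rho>. ?w \<rho> * ennreal \<bar>tr g \<tau> \<rho> * tr g \<tau> \<sigma>\<bar> \<partial>lborel \<partial>lborel \<partial>lborel) < \<infinity>"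
    if g: "continuous_on ({0..t} \<times> {0<..}) (\<lambda>(\<tau>, \<epsilon>). g \<tau> \<epsilon>)" "Ynorm r s t g \<le> ennreal l" for g
  proof -
    have "(\<integral>\<^sup>+\<tau>. \<integral>\<^sup>+\<sigma>. \<integral>\<^sup>+\<rho>. ?w \<rho> * ennreal \<bar>tr g \<tau> \<rho> * tr g \<tau> \<sigma>\<bar> \<partial>lborel \<partial>lborel \<partial>lborel)
      \<le> 2 * ennreal l * Ynorm r s t g * ennreal t"
      \<comment> \<open>Against the zero function, the difference of products is the product itself
        and the distance is the norm of \<open>g\<close>.\<close>
      using product_le[OF g, of "\<lambda>_ _. 0"] a by (simp add: tr_def d_def Ynorm_def)
    also have "\<dots> < \<infinity>"
      using g(2) by (auto simp: ennreal_mult_less_top intro: le_less_trans)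
    finally show ?thesis .
  qed
  have "(\<integral>\<^sup>+\<epsilon>. ?w \<epsilon> * ennreal \<bar>breakage_S K b f_in u a \<epsilon> - breakage_S K b f_in v a \<epsilon>\<bar> \<partial>lborel)
      = (\<integral>\<^sup>+\<epsilon>. ?w \<epsilon> * ennreal \<bar>B u \<epsilon> - B v \<epsilon>\<bar> \<partial>lborel)"
  proof (rule nn_integral_cong)
    show "?w \<epsilon> * ennreal \<bar>breakage_S K b f_in u a \<epsilon> - breakage_S K b f_in v a \<epsilon>\<bar>
      = ?w \<epsilon> * ennreal \<bar>B u \<epsilon> - B v \<epsilon>\<bar>" for \<epsilon>
      by (cases "0 < \<epsilon>") (simp_all add: breakage_S_def N_eq breakage_weight_def)
  qed
  also have "\<dots> \<le> ennreal k * (ennreal \<mu> + 1) *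
    (\<integral>\<^sup>+\<tau>. \<integral>\<^sup>+\<sigma>. \<integral>\<^sup>+\<rho>. ?w \<rho> * ennreal \<bar>tr u \<tau> \<rho> * tr u \<tau> \<sigma> - tr v \<tau> \<rho> * tr v \<tau> \<sigma>\<bar> \<partial>lborel \<partial>lborel \<partial>lborel)"
    unfolding B_def
  proof (rule nn_integral_breakage_diff_le[OF breakage_weight_measurable Kc_meas bc_meas
        tr_meas[OF u_cont] tr_meas[OF v_cont]])
    show "(\<integral>\<^sup>+\<epsilon>. ?w \<epsilon> * ennreal (bc \<epsilon> \<rho> \<sigma>) \<partial>lborel) \<le> ennreal \<mu> * ?w \<rho>" for \<rho> \<sigma>
    proof (cases "0 < \<rho> \<and> 0 < \<sigma>")
      case True
      then show ?thesis
        unfolding bc_def by (intro b) auto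
    next
      case False
      then have "bc \<epsilon> \<rho> \<sigma> = 0" for \<epsilon>
        by (auto simp: bc_def)
      then show ?thesis
        by simp
    qed
  qed (use K0 K b0 k fin[OF u_cont u] fin[OF v_cont v] in \<open>auto simp: Kc_def bc_def intro!: ennreal_leI\<close>)
  also have "\<dots> \<le> ennreal k * (ennreal \<mu> + 1) * (2 * ennreal l * d u v * ennreal t)"
    by (intro mult_left_mono product_le u v u_cont v_cont) auto
  also have "\<dots> = ennreal (2 * t * k * (\<mu> + 1) * l) * d u v"
  proof -
    have "ennreal \<mu> + 1 = ennreal (\<mu> + 1)"
      using \<mu> by simp
    then show ?thesis
      using k \<mu> l t by (simp only: ennreal_mult ennreal_numeral mult_nonneg_nonneg add_nonneg_nonneg
          zero_le_numeral zero_le_one ac_simps)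
  qed
  finally show "(\<integral>\<^sup>+\<epsilon>. ?w \<epsilon> * ennreal \<bar>breakage_S K b f_in u a \<epsilon> - breakage_S K b f_in v a \<epsilon>\<bar> \<partial>lborel)
    \<le> ennreal (2 * t * k * (\<mu> + 1) * l) * Ynorm r s t (\<lambda>\<tau> \<epsilon>. u \<tau> \<epsilon> - v \<tau> \<epsilon>)"
    unfolding d_def .
qed

text \<open>Term \<open>Suc i\<close> is \<open>ahpm_H\<close> at \<open>i\<close>, so each partial
  sum is \<open>f_in\<close> plus a sum of polynomials. The sum subtracted in the last polynomial
  cancels all its predecessors and leaves \<open>breakage_N\<close> of the previous partial sum. The
  case \<open>m = 0\<close> is the start of the recursion for \<open>ahpm_H\<close>, where nothing
  is subtracted.\<close>

lemma ahpm_sol_Suc: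
  "ahpm_sol K b f_in (Suc m) \<tau> \<epsilon> = breakage_S K b f_in (ahpm_sol K b f_in m) \<tau> \<epsilon>"
proof (cases m)
  case 0
  then show ?thesis
    by (simp add: ahpm_sol_def[abs_def] breakage_S_def)
next
  case (Suc n)
  have "(\<Sum>i\<le>Suc n. ahpm_f K b f_in i \<tau> \<epsilon>) = f_in \<epsilon> + (\<Sum>i\<le>n. ahpm_H K b f_in i \<tau> \<epsilon>)"
    by (subst sum.atMost_Suc_shift) simp
  moreover have "ahpm_sol K b f_in m = (\<lambda>\<tau> \<epsilon>. \<Sum>i\<le>Suc n. ahpm_f K b f_in i \<tau> \<epsilon>)"
    using Suc by (intro ext) (simp add: ahpm_sol_def)
  ultimately show ?thesis
    using Suc by (simp add: ahpm_sol_def breakage_S_def)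
qed

section \<open>Convergence and the error bound\<close>

theorem theorem4p4:
  fixes r s t R K1 \<theta> \<eta> Nbar L0 \<mu> \<xi> :: real
    and K :: "real \<Rightarrow> real \<Rightarrow> real"
    and b :: "real \<Rightarrow> real \<Rightarrow> real \<Rightarrow> real"
    and f_in :: "real \<Rightarrow> real"
    and f :: "real \<Rightarrow> real \<Rightarrow> real"
  assumes r: "1 \<le> r" and s: "0 \<le> s" and t: "0 < t" and R: "0 < R"
    and f_in_nonneg: "\<And>\<epsilon>. 0 < \<epsilon> \<Longrightarrow> 0 \<le> f_in \<epsilon>"
    and K_nonneg: "\<And>\<epsilon> \<rho>. 0 \<le> \<epsilon> \<Longrightarrow> 0 \<le> \<rho> \<Longrightarrow> 0 \<le> K \<epsilon> \<rho>"
    and K_sym: "\<And>\<epsilon> \<rho>. 0 \<le> \<epsilon> \<Longrightarrow> 0 \<le> \<rho> \<Longrightarrow> K \<epsilon> \<rho> = K \<rho> \<epsilon>"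
    and K_cont: "continuous_on ({0..} \<times> {0..}) (\<lambda>(\<epsilon>, \<rho>). K \<epsilon> \<rho>)"
    and K_supp: "\<And>\<epsilon> \<rho>. 0 \<le> \<epsilon> \<Longrightarrow> 0 \<le> \<rho> \<Longrightarrow> (\<epsilon>, \<rho>) \<notin> {0..R} \<times> {0..R} \<Longrightarrow> K \<epsilon> \<rho> = 0"
    and K1: "K1 = (SUP (\<epsilon>, \<rho>)\<in>{s / R..R} \<times> {s / R..R}. K \<epsilon> \<rho>)"
    and K_le_K1: "\<And>\<epsilon> \<rho>. 0 < s \<Longrightarrow> 0 < \<epsilon> \<Longrightarrow> \<epsilon> \<le> R \<Longrightarrow> 0 < \<rho> \<Longrightarrow> \<rho> \<le> R \<Longrightarrow> K \<epsilon> \<rho> \<le> K1"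
    and b_nonneg: "\<And>\<epsilon> \<rho> \<sigma>. 0 < \<epsilon> \<Longrightarrow> 0 < \<rho> \<Longrightarrow> 0 < \<sigma> \<Longrightarrow> 0 \<le> b \<epsilon> \<rho> \<sigma>"
    and b_cont: "continuous_on ({0<..} \<times> {0<..} \<times> {0<..}) (\<lambda>(\<epsilon>, \<rho>, \<sigma>). b \<epsilon> \<rho> \<sigma>)"
    and b_nonzero: "\<And>\<epsilon> \<rho> \<sigma>. 0 < \<epsilon> \<Longrightarrow> \<epsilon> < \<rho> \<Longrightarrow> 0 < \<sigma> \<Longrightarrow> b \<epsilon> \<rho> \<sigma> \<noteq> 0"
    and b_zero: "\<And>\<epsilon> \<rho> \<sigma>. 0 < \<rho> \<Longrightarrow> \<rho> < \<epsilon> \<Longrightarrow> 0 < \<sigma> \<Longrightarrow> b \<epsilon> \<rho> \<sigma> = 0"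
    and b_mass: "\<And>\<rho> \<sigma>. 0 < \<rho> \<Longrightarrow> 0 < \<sigma> \<Longrightarrow>
          (\<integral>\<^sup>+\<epsilon>\<in>{0<..<\<rho>}. ennreal (\<epsilon> * b \<epsilon> \<rho> \<sigma>) \<partial>lborel) = ennreal \<rho>"
    and b_number: "\<And>\<rho> \<sigma>. 0 < \<rho> \<Longrightarrow> 0 < \<sigma> \<Longrightarrow>
          (\<integral>\<^sup>+\<epsilon>\<in>{0<..<\<rho>}. ennreal (b \<epsilon> \<rho> \<sigma>) \<partial>lborel) \<le> ennreal Nbar"
    and \<theta>: "0 < \<theta>" and \<eta>: "0 < \<eta>"
    and \<theta>_ge_2: "0 < s \<Longrightarrow> 2 \<le> \<theta>"
    and b_sing: "\<And>\<rho> \<sigma>. 0 < \<rho> \<Longrightarrow> 0 < \<sigma> \<Longrightarrow>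
          (\<integral>\<^sup>+\<epsilon>\<in>{0<..}. ennreal (\<epsilon> powr (- \<theta> * s) * b \<epsilon> \<rho> \<sigma>) \<partial>lborel)
            \<le> ennreal (\<eta> * \<rho> powr (- \<theta> * s))"
    and f_exact: "exact_solution r s t K b f_in f"
    and L0: "0 \<le> L0"
    and f_bound: "Ynorm r s t f \<le> ennreal L0"
    and ahpm_in_Y: "\<And>m. ahpm_sol K b f_in m \<in> Yspace r s t"
    and ahpm_bound: "\<And>m. Ynorm r s t (ahpm_sol K b f_in m) \<le> ennreal L0"
    and \<mu>: "\<mu> = max Nbar \<eta>"
    and \<xi>: "\<xi> = 2 * t * K1 * (\<mu> + 1) * L0"
    and \<xi>_less_1: "\<xi> < 1"
    and f1_finite: "Ynorm r s t (ahpm_f K b f_in 1) < \<infinity>"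
  shows "((\<lambda>m. Ynorm r s t (\<lambda>\<tau> \<epsilon>. f \<tau> \<epsilon> - ahpm_sol K b f_in m \<tau> \<epsilon>)) \<longlonglongrightarrow> 0) \<and>
         (\<forall>m. Ynorm r s t (\<lambda>\<tau> \<epsilon>. f \<tau> \<epsilon> - ahpm_sol K b f_in m \<tau> \<epsilon>)
                \<le> ennreal (\<xi> ^ m / (1 - \<xi>)) * Ynorm r s t (ahpm_f K b f_in 1))"
proof -
  let ?\<Upsilon> = "ahpm_sol K b f_in"
  let ?bc = "\<lambda>\<epsilon> \<rho> \<sigma>. if 0 < \<epsilon> \<and> \<epsilon> < \<rho> \<and> 0 < \<sigma> then b \<epsilon> \<rho> \<sigma> else 0"
  \<comment> \<open>At \<open>\<rho> = \<sigma> = 1\<close> the mass is \<open>1\<close>, and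
    \<open>\<epsilon> < 1\<close> on the support makes the number of fragments at least the mass.
    This yields \<open>1 \<le> \<mu>\<close>, which the moment estimate requires.\<close>
  have Nbar: "1 \<le> Nbar"
  proof -
    have "ennreal 1 = (\<integral>\<^sup>+\<epsilon>\<in>{0<..<1}. ennreal (\<epsilon> * b \<epsilon> 1 1) \<partial>lborel)"
      by (rule b_mass[symmetric]) auto
    also have "\<dots> \<le> (\<integral>\<^sup>+\<epsilon>\<in>{0<..<1}. ennreal (b \<epsilon> 1 1) \<partial>lborel)"
      using b_nonneg by (intro nn_integral_mono) (auto simp: indicator_def intro!: ennreal_leI mult_left_le_one_le)
    also have "\<dots> \<le> ennreal Nbar"
      by (rule b_number) auto
    finally have "1 \<le> ennreal Nbar"
      by simp
    then show ?thesis
      by simp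
  qed
  then have \<mu>1: "1 \<le> \<mu>" and \<mu>_Nbar: "Nbar \<le> \<mu>" and \<mu>_\<eta>: "\<eta> \<le> \<mu>"
    using \<mu> by auto
  \<comment> \<open>For \<open>0 < s\<close> the supremum defining \<open>K1\<close> only sees sizes
    from \<open>s / R\<close> on, and \<open>K_le_K1\<close> covers the smaller ones. For
    \<open>s = 0\<close> it ranges over the full closed square, where compactness bounds the image;
    a real supremum is meaningful only for a bounded set.\<close>
  have K_le_box: "K \<rho> \<sigma> \<le> K1" if "0 < \<rho>" "\<rho> \<le> R" "0 < \<sigma>" "\<sigma> \<le> R" for \<rho> \<sigma>
  proof (cases "0 < s")
    case True
    then show ?thesis
      using K_le_K1 that by auto
  next
    case False
    with s have K1_eq: "K1 = (SUP (\<epsilon>, \<rho>)\<in>{0..R} \<times> {0..R}. K \<epsilon> \<rho>)"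
      using K1 by simp
    have "compact ((\<lambda>(\<epsilon>, \<rho>). K \<epsilon> \<rho>) ` ({0..R} \<times> {0..R}))"
      by (intro compact_continuous_image compact_Times continuous_on_subset[OF K_cont]) auto
    then have "bdd_above ((\<lambda>(\<epsilon>, \<rho>). K \<epsilon> \<rho>) ` ({0..R} \<times> {0..R}))"
      by (intro bounded_imp_bdd_above compact_imp_bounded)
    then show ?thesis
      unfolding K1_eq using that by (intro cSUP_upper2[where x = "(\<rho>, \<sigma>)"]) auto
  qed
  have K1_nonneg: "0 \<le> K1"
    using K_le_box[of R R] K_nonneg[of R R] R by auto
  \<comment> \<open>Beyond the square of side \<open>R\<close> the kernel vanishes, and
    \<open>K1\<close> is non-negative.\<close>
  have K_le: "K \<rho> \<sigma> \<le> K1" if "0 < \<rho>" "0 < \<sigma>" for \<rho> \<sigma>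
    using K_le_box[of \<rho> \<sigma>] K_supp[of \<rho> \<sigma>] K1_nonneg that by (cases "\<rho> \<le> R \<and> \<sigma> \<le> R") auto
  have bc_meas: "(\<lambda>(\<epsilon>, \<rho>, \<sigma>). ?bc \<epsilon> \<rho> \<sigma>) \<in> borel_measurable (borel \<Otimes>\<^sub>M borel \<Otimes>\<^sub>M borel)"
  proof -
    have "(\<lambda>z. indicator ({0<..} \<times> {0<..} \<times> {0<..}) z *\<^sub>R (case z of (\<epsilon>, \<rho>, \<sigma>) \<Rightarrow> b \<epsilon> \<rho> \<sigma>))
        \<in> borel_measurable borel"
      by (intro borel_measurable_continuous_on_indicator borel_Times b_cont) auto
    then have [measurable]: "(\<lambda>z. indicator ({0<..} \<times> {0<..} \<times> {0<..}) z *\<^sub>R (case z of (\<epsilon>, \<rho>, \<sigma>) \<Rightarrow> b \<epsilon> \<rho> \<sigma>))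
        \<in> borel_measurable (borel \<Otimes>\<^sub>M borel \<Otimes>\<^sub>M borel)"
      by (simp only: borel_prod)
    have "(\<lambda>z. if fst z < fst (snd z)
        then indicator ({0<..} \<times> {0<..} \<times> {0<..}) z *\<^sub>R (case z of (\<epsilon>, \<rho>, \<sigma>) \<Rightarrow> b \<epsilon> \<rho> \<sigma>) else 0)
        \<in> borel_measurable (borel \<Otimes>\<^sub>M borel \<Otimes>\<^sub>M borel)"
      by measurable
    then show ?thesis
      by (rule measurable_cong[THEN iffD1, rotated]) (auto simp: indicator_def split: if_splits)
  qed
  have moment: "(\<integral>\<^sup>+\<epsilon>. breakage_weight r s \<epsilon> * ennreal (?bc \<epsilon> \<rho> \<sigma>) \<partial>lborel)
      \<le> ennreal \<mu> * breakage_weight r s \<rho>" if \<rho>\<sigma>: "0 < \<rho>" "0 < \<sigma>" for \<rho> \<sigma>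
  proof (rule breakage_weight_moment_le[OF _ _ _ \<rho>\<sigma>(1) r \<mu>1])
    note [measurable] = borel_measurable_curried3[OF bc_meas]
    show [measurable]: "(\<lambda>\<epsilon>. ?bc \<epsilon> \<rho> \<sigma>) \<in> borel_measurable borel"
      by measurable
    show "(\<integral>\<^sup>+\<epsilon>. ennreal (\<epsilon> * ?bc \<epsilon> \<rho> \<sigma>) \<partial>lborel) \<le> ennreal \<rho>"
      unfolding b_mass[OF \<rho>\<sigma>, symmetric] using \<rho>\<sigma>
      by (intro nn_integral_mono) (auto simp: indicator_def)
    show "(\<integral>\<^sup>+\<epsilon>. ennreal (\<epsilon> powr (- 2 * s) * ?bc \<epsilon> \<rho> \<sigma>) \<partial>lborel) \<le> ennreal (\<mu> * \<rho> powr (- 2 * s))"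
    \<comment> \<open>Both constituents of \<open>\<mu>\<close> enter here. For
      \<open>0 < s\<close>, \<open>2 \<le> \<theta>\<close> lets the surplus power
      \<open>\<epsilon> powr (\<theta> * s - 2 * s)\<close> be bounded by its value at
      \<open>\<rho>\<close>; the assumed singular moment then gives
      \<open>\<eta> * \<rho> powr (- 2 * s)\<close>. For \<open>s = 0\<close> the integrand is
      \<open>b\<close> itself, and the number bound \<open>Nbar\<close> applies.\<close>
    proof (cases "0 < s")
      case True
      have "(\<integral>\<^sup>+\<epsilon>. ennreal (\<epsilon> powr (- 2 * s) * ?bc \<epsilon> \<rho> \<sigma>) \<partial>lborel)
          \<le> (\<integral>\<^sup>+\<epsilon>. ennreal (\<rho> powr (\<theta> * s - 2 * s)) * ennreal (\<epsilon> powr (- \<theta> * s) * ?bc \<epsilon> \<rho> \<sigma>) \<partial>lborel)"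
      proof (rule nn_integral_mono)
        fix \<epsilon> :: real
        show "ennreal (\<epsilon> powr (- 2 * s) * ?bc \<epsilon> \<rho> \<sigma>)
            \<le> ennreal (\<rho> powr (\<theta> * s - 2 * s)) * ennreal (\<epsilon> powr (- \<theta> * s) * ?bc \<epsilon> \<rho> \<sigma>)"
        proof (cases "0 < \<epsilon> \<and> \<epsilon> < \<rho>")
          case \<epsilon>: True
          have "\<epsilon> powr (- 2 * s) = \<epsilon> powr (\<theta> * s - 2 * s) * \<epsilon> powr (- \<theta> * s)"
            by (simp flip: powr_add)
          also have "\<dots> \<le> \<rho> powr (\<theta> * s - 2 * s) * \<epsilon> powr (- \<theta> * s)"
            using \<epsilon> True \<theta>_ge_2 by (intro mult_right_mono powr_mono2) auto
          finally have "\<epsilon> powr (- 2 * s) \<le> \<rho> powr (\<theta> * s - 2 * s) * \<epsilon> powr (- \<theta> * s)" .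
          from mult_right_mono[OF this b_nonneg[of \<epsilon> \<rho> \<sigma>]] show ?thesis
            using \<epsilon> \<rho>\<sigma> b_nonneg[of \<epsilon> \<rho> \<sigma>] by (simp add: ennreal_leI mult.assoc flip: ennreal_mult)
        qed auto
      qed
      also have "\<dots> = ennreal (\<rho> powr (\<theta> * s - 2 * s))
          * (\<integral>\<^sup>+\<epsilon>. ennreal (\<epsilon> powr (- \<theta> * s) * ?bc \<epsilon> \<rho> \<sigma>) \<partial>lborel)"
        by (rule nn_integral_cmult) measurable
      also have "\<dots> \<le> ennreal (\<rho> powr (\<theta> * s - 2 * s))
          * (\<integral>\<^sup>+\<epsilon>\<in>{0<..}. ennreal (\<epsilon> powr (- \<theta> * s) * b \<epsilon> \<rho> \<sigma>) \<partial>lborel)"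
        using \<rho>\<sigma> by (intro mult_left_mono nn_integral_mono) (auto simp: indicator_def)
      also have "\<dots> \<le> ennreal (\<rho> powr (\<theta> * s - 2 * s)) * ennreal (\<eta> * \<rho> powr (- \<theta> * s))"
        by (intro mult_left_mono b_sing \<rho>\<sigma>) auto
      also have "\<dots> = ennreal (\<eta> * \<rho> powr (- 2 * s))"
        using \<eta> by (simp add: mult.left_commute flip: ennreal_mult powr_add)
      also have "\<dots> \<le> ennreal (\<mu> * \<rho> powr (- 2 * s))"
        using \<mu>_\<eta> by (intro ennreal_leI mult_right_mono) auto
      finally show ?thesis .
    next
      case False
      with s have s0: "s = 0"
        by simp
      have "(\<integral>\<^sup>+\<epsilon>. ennreal (\<epsilon> powr (- 2 * s) * ?bc \<epsilon> \<rho> \<sigma>) \<partial>lborel)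
          = (\<integral>\<^sup>+\<epsilon>\<in>{0<..<\<rho>}. ennreal (b \<epsilon> \<rho> \<sigma>) \<partial>lborel)"
        using s0 \<rho>\<sigma> by (intro nn_integral_cong) (auto simp: indicator_def)
      also have "\<dots> \<le> ennreal \<mu>"
        using \<mu>_Nbar by (intro order_trans[OF b_number[OF \<rho>\<sigma>]] ennreal_leI)
      finally show ?thesis
        using s0 \<rho>\<sigma> by simp
    qed
  qed (use b_nonneg \<rho>\<sigma> in auto)
  have f_Y: "continuous_on ({0..t} \<times> {0<..}) (\<lambda>(\<tau>, \<epsilon>). f \<tau> \<epsilon>)"
    and f_fixed: "\<And>\<tau> \<epsilon>. \<tau> \<in> {0..t} \<Longrightarrow> 0 < \<epsilon> \<Longrightarrow> f \<tau> \<epsilon> = breakage_S K b f_in f \<tau> \<epsilon>"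
    using f_exact by (auto simp: exact_solution_def Yplus_def Yspace_def)
  have \<Upsilon>_Y: "continuous_on ({0..t} \<times> {0<..}) (\<lambda>(\<tau>, \<epsilon>). ?\<Upsilon> m \<tau> \<epsilon>)" for m
    using ahpm_in_Y[of m] by (simp add: Yspace_def)
  define d where "d m = Ynorm r s t (\<lambda>\<tau> \<epsilon>. f \<tau> \<epsilon> - ?\<Upsilon> m \<tau> \<epsilon>)" for m
  have \<xi>0: "0 \<le> \<xi>"
    using \<xi> t K1_nonneg \<mu>1 L0 by simp
  have step: "d (Suc m) \<le> ennreal \<xi> * d m" for m
  proof -
    \<comment> \<open>On the relevant domain \<open>f\<close> is fixed by \<open>breakage_S\<close>,
      and the next truncated solution is the image of the current one; both arguments lie in the
      ball of radius \<open>L0\<close>.\<close>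
    have "d (Suc m) = Ynorm r s t (\<lambda>\<tau> \<epsilon>. breakage_S K b f_in f \<tau> \<epsilon> - breakage_S K b f_in (?\<Upsilon> m) \<tau> \<epsilon>)"
      unfolding d_def by (rule Ynorm_cong) (simp only: f_fixed[symmetric] ahpm_sol_Suc)
    also have "\<dots> \<le> ennreal \<xi> * d m"
      unfolding d_def \<xi> using r s t K1_nonneg \<mu>1 L0 K_nonneg K_le b_nonneg
      by (intro Ynorm_breakage_S_diff_le bc_meas moment f_Y \<Upsilon>_Y f_bound ahpm_bound
          continuous_on_subset[OF K_cont]) auto
    finally show ?thesis .
  qed
  have power: "d m \<le> ennreal (\<xi> ^ m) * d 0" for m
  proof (induction m)
    case (Suc m)
    have "d (Suc m) \<le> ennreal \<xi> * (ennreal (\<xi> ^ m) * d 0)"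
      by (intro order_trans[OF step] mult_left_mono Suc.IH) auto
    then show ?case
      using \<xi>0 by (simp add: ennreal_mult mult.assoc)
  qed simp
  \<comment> \<open>Finiteness of \<open>d 0\<close> permits the passage from \<open>ennreal\<close>
    to the reals, where an inequality with \<open>x\<close> on both sides can be solved.\<close>
  have "d 0 \<le> Ynorm r s t f + Ynorm r s t (?\<Upsilon> 0)"
    unfolding d_def by (intro Ynorm_add_le f_Y \<Upsilon>_Y) auto
  also have "\<dots> < \<infinity>"
    using f_bound ahpm_bound[of 0] by (auto intro: le_less_trans)
  finally obtain x where x: "0 \<le> x" "d 0 = ennreal x"
    by (cases "d 0") auto
  obtain y where y: "0 \<le> y" "Ynorm r s t (ahpm_f K b f_in 1) = ennreal y"
    using f1_finite by (cases "Ynorm r s t (ahpm_f K b f_in 1)") auto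
  have f1_eq: "ahpm_f K b f_in 1 = (\<lambda>\<tau> \<epsilon>. ?\<Upsilon> 1 \<tau> \<epsilon> - ?\<Upsilon> 0 \<tau> \<epsilon>)"
    by (intro ext) (simp add: ahpm_sol_def)
  \<comment> \<open>The initial error is the error after one step plus the first correction. With
    \<open>d 1 \<le> \<xi> * d 0\<close> this becomes \<open>x \<le> \<xi> * x + y\<close>, and
    solving for \<open>x\<close> produces the denominator \<open>1 - \<xi>\<close>.\<close>
  have "d 0 \<le> d 1 + Ynorm r s t (ahpm_f K b f_in 1)"
    unfolding d_def f1_eq
    using continuous_on_diff[OF f_Y \<Upsilon>_Y[of 1]] continuous_on_diff[OF \<Upsilon>_Y[of 1] \<Upsilon>_Y[of 0]]
    by (intro Ynorm_add_le) (auto simp: split_beta)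
  also have "\<dots> \<le> ennreal (\<xi> * x) + ennreal y"
    using step[of 0] \<xi>0 x y by (intro add_mono) (simp_all add: ennreal_mult)
  finally have "x \<le> \<xi> * x + y"
    using x y \<xi>0 by (simp flip: ennreal_plus)
  then have "x \<le> y / (1 - \<xi>)"
    using \<xi>_less_1 by (simp add: field_simps)
  then have "ennreal (\<xi> ^ m) * d 0 \<le> ennreal (\<xi> ^ m * (y / (1 - \<xi>)))" for m
    using \<xi>0 x by (simp del: times_divide_eq_right add: mult_left_mono ennreal_leI flip: ennreal_mult)
  then have bound: "d m \<le> ennreal (\<xi> ^ m * (y / (1 - \<xi>)))" for m
    using power order_trans by blast
  have "(\<lambda>m. ennreal (\<xi> ^ m * (y / (1 - \<xi>)))) \<longlonglongrightarrow> ennreal (0 * (y / (1 - \<xi>)))"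
    using \<xi>0 \<xi>_less_1 by (intro tendsto_ennrealI tendsto_mult_right LIMSEQ_power_zero) auto
  then have "d \<longlonglongrightarrow> 0"
    by (intro tendsto_sandwich[of "\<lambda>_. 0" d _ "\<lambda>m. ennreal (\<xi> ^ m * (y / (1 - \<xi>)))"])
       (simp_all add: bound del: times_divide_eq_right)
  moreover have "d m \<le> ennreal (\<xi> ^ m / (1 - \<xi>)) * Ynorm r s t (ahpm_f K b f_in 1)" for m
    using bound[of m] y \<xi>0 \<xi>_less_1 by (simp flip: ennreal_mult)
  ultimately show ?thesis
    unfolding d_def[abs_def] by blast
qed

end
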